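(* Let $(M=\mathbb{R}\times M_0,\langle\cdot,\cdot\rangle)$ be a standard stationary spacetime, with $\langle\cdot,\cdot\rangle=-\beta(x)\,dt^2+\langle\cdot,\cdot\rangle_R+2\langle\delta,\cdot\rangle_R\,dt$, and let $\gamma(s)=(t(s),x(s))$ be a curve in $M$. Then $\gamma$ is a geodesic of $M$ if and only if $E=\langle\gamma',\partial_t\rangle$ is constant and, with this value of $E$, $x(s)$ satisfies $$\nabla^R_{x'}x'=\overline R_0(x)+\overline R_1(x,x')+\overline R_2(x,x'\otimes x'),$$ where $$\overline R_0(x)=\frac{E^2}{\beta^2}R_0(x),$$ $$\overline R_1(x,x')=-\frac{E}{\beta}\Big(2\frac{\langle\delta,x'\rangle_R}{\beta}R_0(x)+R_1(x,x')\Big),$$ $$\overline R_2(x,x'\otimes x')=\frac{\langle\delta,x'\rangle_R^2}{\beta^2}R_0(x)+\frac{\langle\delta,x'\rangle_R}{\beta}R_1(x,x')+R_2(x,(x',x')),$$ and $$R_0(x)=-\tfrac12\big(\Lambda\langle\delta,\nabla^R\beta\rangle_R\,\delta+\nabla^R\beta\big)(x),$$ $$R_1(x,x')=-\Lambda\big(\langle\nabla^R\beta,x'\rangle_R+\mathrm{rot}\,\delta(x',\delta)\big)\delta(x)+\mathrm{rot}\,\delta(\cdot,x')^{\natural},$$ $$R_2(x,(x',\overline{x}'))=\Lambda\,\mathrm{Sym}\nabla^R\delta(x',\overline{x}')\,\delta(x),$$ with $\Lambda=-1/(\beta+\|\delta\|_R^2)$.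
   Context: A (standard) stationary spacetime is the product manifold $M=\mathbb{R}\times M_0$, where $(M_0,\langle\cdot,\cdot\rangle_R)$ is a Riemannian manifold, endowed with the Lorentz metric $\langle\cdot,\cdot\rangle=-\beta(x)\,dt^2+\langle\cdot,\cdot\rangle_R+2\langle\delta,\cdot\rangle_R\,dt$, where $\delta$ is a smooth vector field on $M_0$ and $\beta$ is a positive smooth function on $M_0$; that is, $\langle(\tau,v),(\tau,v)\rangle=-\beta(x)\tau^2+\langle v,v\rangle_R+2\tau\langle\delta(x),v\rangle_R$ for $\tau\in\mathbb{R}$, $v\in T_xM_0$. $\nabla^R$ denotes the Levi-Civita connection of $\langle\cdot,\cdot\rangle_R$ and $\nabla^R\beta$ the $\langle\cdot,\cdot\rangle_R$-gradient of $\beta$; $\|\cdot\|_R$ is the $\langle\cdot,\cdot\rangle_R$-norm. One writes $\nabla^R\delta(V,W)=\langle\nabla^R_V\delta,W\rangle_R$, $\mathrm{Sym}\nabla^R\delta(V,W)=\frac12(\nabla^R\delta(V,W)+\nabla^R\delta(W,V))$ and $\mathrm{rot}\,\delta(V,W)=\nabla^R\delta(V,W)-\nabla^R\delta(W,V)$. The symbol $^{\natural}$ denotes the vector $\langle\cdot,\cdot\rangle_R$-metrically associated to a 1-form on $M_0$: $\langle Y,\mathrm{rot}\,\delta(\cdot,x')^{\natural}\rangle_R=\mathrm{rot}\,\delta(Y,x')$. Curves are smooth; the functions and tensors on $M_0$ in the equation are evaluated at $x(s)$. A geodesic is a curve with $\nabla_{\gamma'}\gamma'=0$ for the Levi-Civita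 connection $\nabla$ of $\langle\cdot,\cdot\rangle$. *)

theory Defs
  imports "HOL-Analysis.Analysis" "HOL-Library.Function_Algebras"
begin

text \<open>
  A manifold is a type \<open>'a\<close> with an atlas of charts into a Euclidean space \<open>'e\<close>. Tangent vectors at
  \<open>p\<close> are the directional-derivative operators on functions that are smooth near \<open>p\<close>. Connections are
  operators on locally defined vector fields; a field is a total function whose values matter only
  near the point in question.
\<close>

instantiation "fun" :: (type, real_vector) real_vector
begin

definition scaleR_fun :: "real \<Rightarrow> ('a \<Rightarrow> 'b) \<Rightarrow> 'a \<Rightarrow> 'b"
  where "scaleR_fun r f = (\<lambda>x. r *\<^sub>R f x)"

instance
  by standard (auto simp: scaleR_fun_def plus_fun_def scaleR_add_right scaleR_add_left)

end

subsection \<open>Smooth manifolds\<close>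

primrec Ck_on :: "nat \<Rightarrow> 'a::real_normed_vector set \<Rightarrow> ('a \<Rightarrow> 'b::real_normed_vector) \<Rightarrow> bool" where
  "Ck_on 0 S f \<longleftrightarrow> continuous_on S f"
| "Ck_on (Suc k) S f \<longleftrightarrow> (\<forall>x\<in>S. f differentiable (at x)) \<and>
     (\<forall>v. Ck_on k S (\<lambda>x. frechet_derivative f (at x) v))"

text \<open>Only used for open \<open>S\<close> in Euclidean spaces, where it says that all iterated directional
  derivatives exist and are differentiable, i.e. that \<open>f\<close> is of class \<open>C\<^sup>\<infinity>\<close>.\<close>

definition smooth_on :: "'a::real_normed_vector set \<Rightarrow> ('a \<Rightarrow> 'b::real_normed_vector) \<Rightarrow> bool"
  where "smooth_on S f \<longleftrightarrow> (\<forall>k. Ck_on k S f)"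

text \<open>A chart is a pair of a domain and a coordinate map.\<close>

type_synonym ('a, 'e) chart = "'a set \<times> ('a \<Rightarrow> 'e)"

definition smooth_atlas :: "('a::topological_space, 'e::euclidean_space) chart set \<Rightarrow> bool"
  where "smooth_atlas A \<longleftrightarrow>
    (\<Union>(U, \<phi>)\<in>A. U) = UNIV \<and>
    (\<forall>(U, \<phi>)\<in>A. open U \<and> open (\<phi> ` U) \<and> homeomorphism U (\<phi> ` U) \<phi> (inv_into U \<phi>)) \<and>
    (\<forall>(U, \<phi>)\<in>A. \<forall>(V, \<psi>)\<in>A. smooth_on (\<phi> ` (U \<inter> V)) (\<psi> \<circ> inv_into U \<phi>))"

definition smooth_fun_on ::
    "('a::topological_space, 'e::euclidean_space) chart set \<Rightarrow> 'a set \<Rightarrow> ('a \<Rightarrow> real) \<Rightarrow> bool"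
  where "smooth_fun_on A W f \<longleftrightarrow> (\<forall>(U, \<phi>)\<in>A. smooth_on (\<phi> ` (W \<inter> U)) (f \<circ> inv_into U \<phi>))"

definition smooth_near ::
    "('a::topological_space, 'e::euclidean_space) chart set \<Rightarrow> 'a \<Rightarrow> ('a \<Rightarrow> real) \<Rightarrow> bool"
  where "smooth_near A p f \<longleftrightarrow> (\<exists>W. open W \<and> p \<in> W \<and> smooth_fun_on A W f)"

subsection \<open>Tangent vectors and vector fields\<close>

type_synonym 'a tvec = "('a \<Rightarrow> real) \<Rightarrow> real"

text \<open>\<open>coord_vec A c p a\<close> is the derivative at \<open>p\<close> in the direction with components \<open>a\<close> in the chart
  \<open>c\<close>. Here and below tangent vectors are set to \<open>0\<close> on functions that are not smooth near \<open>p\<close>, so that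
  they are determined by their action on germs of smooth functions.\<close>

definition coord_vec :: "('a::topological_space, 'e::euclidean_space) chart set \<Rightarrow>
    ('a, 'e) chart \<Rightarrow> 'a \<Rightarrow> 'e \<Rightarrow> 'a tvec"
  where "coord_vec A c p a = (\<lambda>f. if smooth_near A p f
    then frechet_derivative (f \<circ> inv_into (fst c) (snd c)) (at (snd c p)) a else 0)"

definition tangent_space ::
    "('a::topological_space, 'e::euclidean_space) chart set \<Rightarrow> 'a \<Rightarrow> 'a tvec set"
  where "tangent_space A p = {coord_vec A c p a | c a. c \<in> A \<and> p \<in> fst c}"

definition differential :: "('b::topological_space, 'f::euclidean_space) chart set \<Rightarrow>
    ('a \<Rightarrow> 'b) \<Rightarrow> 'a \<Rightarrow> 'a tvec \<Rightarrow> 'b tvec"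
  where "differential B F p w = (\<lambda>f. if smooth_near B (F p) f then w (f \<circ> F) else 0)"

definition smooth_vf_on :: "('a::topological_space, 'e::euclidean_space) chart set \<Rightarrow>
    'a set \<Rightarrow> ('a \<Rightarrow> 'a tvec) \<Rightarrow> bool"
  where "smooth_vf_on A U X \<longleftrightarrow> (\<forall>p\<in>U. X p \<in> tangent_space A p) \<and>
    (\<forall>W f. open W \<longrightarrow> W \<subseteq> U \<longrightarrow> smooth_fun_on A W f \<longrightarrow> smooth_fun_on A W (\<lambda>p. X p f))"

definition smooth_vf_near :: "('a::topological_space, 'e::euclidean_space) chart set \<Rightarrow>
    'a \<Rightarrow> ('a \<Rightarrow> 'a tvec) \<Rightarrow> bool"
  where "smooth_vf_near A p X \<longleftrightarrow> (\<exists>U. open U \<and> p \<in> U \<and> smooth_vf_on A U X)"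

definition lie_bracket :: "('a::topological_space, 'e::euclidean_space) chart set \<Rightarrow>
    ('a \<Rightarrow> 'a tvec) \<Rightarrow> ('a \<Rightarrow> 'a tvec) \<Rightarrow> 'a \<Rightarrow> 'a tvec"
  where "lie_bracket A X Y p = (\<lambda>f. if smooth_near A p f
    then X p (\<lambda>q. Y q f) - Y p (\<lambda>q. X q f) else 0)"

subsection \<open>Metrics\<close>

type_synonym 'a metric_tensor = "'a \<Rightarrow> 'a tvec \<Rightarrow> 'a tvec \<Rightarrow> real"

definition riemannian_metric ::
    "('a::topological_space, 'e::euclidean_space) chart set \<Rightarrow> 'a metric_tensor \<Rightarrow> bool"
  where "riemannian_metric A g \<longleftrightarrow>
    (\<forall>p. \<forall>u\<in>tangent_space A p. \<forall>v\<in>tangent_space A p. \<forall>w\<in>tangent_space A p. \<forall>a b.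
       g p (a *\<^sub>R u + b *\<^sub>R v) w = a * g p u w + b * g p v w) \<and>
    (\<forall>p. \<forall>u\<in>tangent_space A p. \<forall>v\<in>tangent_space A p. g p u v = g p v u) \<and>
    (\<forall>p. \<forall>v\<in>tangent_space A p. v \<noteq> 0 \<longrightarrow> g p v v > 0) \<and>
    (\<forall>U X Y. open U \<longrightarrow> smooth_vf_on A U X \<longrightarrow> smooth_vf_on A U Y \<longrightarrow>
       smooth_fun_on A U (\<lambda>p. g p (X p) (Y p)))"

definition metric_norm :: "'a metric_tensor \<Rightarrow> 'a \<Rightarrow> 'a tvec \<Rightarrow> real"
  where "metric_norm g p v = sqrt (g p v v)"

definition sharp :: "('a::topological_space, 'e::euclidean_space) chart set \<Rightarrow>
    'a metric_tensor \<Rightarrow> 'a \<Rightarrow> ('a tvec \<Rightarrow> real) \<Rightarrow> 'a tvec"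
  where "sharp A g p \<omega> =
    (THE w. w \<in> tangent_space A p \<and> (\<forall>v\<in>tangent_space A p. g p v w = \<omega> v))"

definition grad :: "('a::topological_space, 'e::euclidean_space) chart set \<Rightarrow>
    'a metric_tensor \<Rightarrow> ('a \<Rightarrow> real) \<Rightarrow> 'a \<Rightarrow> 'a tvec"
  where "grad A g f p = sharp A g p (\<lambda>v. v f)"

subsection \<open>The Levi-Civita connection\<close>

text \<open>\<open>nab p v Y\<close> stands for \<open>\<nabla>\<^sub>v Y\<close> with \<open>v\<close> tangent at \<open>p\<close> and \<open>Y\<close> a vector field smooth near \<open>p\<close>; it
  is unconstrained for other arguments. That \<open>nab p v Y\<close> only depends on \<open>Y\<close> near \<open>p\<close> follows from
  the Leibniz rule, applied with the indicator function of a neighbourhood of \<open>p\<close>.\<close>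

type_synonym 'a connection = "'a \<Rightarrow> 'a tvec \<Rightarrow> ('a \<Rightarrow> 'a tvec) \<Rightarrow> 'a tvec"

definition affine_connection ::
    "('a::topological_space, 'e::euclidean_space) chart set \<Rightarrow> 'a connection \<Rightarrow> bool"
  where "affine_connection A nab \<longleftrightarrow>
    (\<forall>p Y. \<forall>v\<in>tangent_space A p. smooth_vf_near A p Y \<longrightarrow> nab p v Y \<in> tangent_space A p) \<and>
    (\<forall>p Y a b. \<forall>u\<in>tangent_space A p. \<forall>v\<in>tangent_space A p. smooth_vf_near A p Y \<longrightarrow>
       nab p (a *\<^sub>R u + b *\<^sub>R v) Y = a *\<^sub>R nab p u Y + b *\<^sub>R nab p v Y) \<and>
    (\<forall>p Y Z. \<forall>v\<in>tangent_space A p. smooth_vf_near A p Y \<longrightarrow> smooth_vf_near A p Z \<longrightarrow>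
       nab p v (\<lambda>q. Y q + Z q) = nab p v Y + nab p v Z) \<and>
    (\<forall>p f Y. \<forall>v\<in>tangent_space A p. smooth_near A p f \<longrightarrow> smooth_vf_near A p Y \<longrightarrow>
       nab p v (\<lambda>q. f q *\<^sub>R Y q) = v f *\<^sub>R Y p + f p *\<^sub>R nab p v Y) \<and>
    (\<forall>U X Y. open U \<longrightarrow> smooth_vf_on A U X \<longrightarrow> smooth_vf_on A U Y \<longrightarrow>
       smooth_vf_on A U (\<lambda>p. nab p (X p) Y))"

definition levi_civita :: "('a::topological_space, 'e::euclidean_space) chart set \<Rightarrow>
    'a metric_tensor \<Rightarrow> 'a connection \<Rightarrow> bool"
  where "levi_civita A g nab \<longleftrightarrow> affine_connection A nab \<and>
    (\<forall>p X Y. smooth_vf_near A p X \<longrightarrow> smooth_vf_near A p Y \<longrightarrow>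
       nab p (X p) Y - nab p (Y p) X = lie_bracket A X Y p) \<and>
    (\<forall>p Y Z. \<forall>v\<in>tangent_space A p. smooth_vf_near A p Y \<longrightarrow> smooth_vf_near A p Z \<longrightarrow>
       v (\<lambda>q. g q (Y q) (Z q)) = g p (nab p v Y) (Z p) + g p (Y p) (nab p v Z))"

subsection \<open>Curves and geodesics\<close>

definition smooth_curve :: "('a::topological_space, 'e::euclidean_space) chart set \<Rightarrow>
    real set \<Rightarrow> (real \<Rightarrow> 'a) \<Rightarrow> bool"
  where "smooth_curve A I \<gamma> \<longleftrightarrow> continuous_on I \<gamma> \<and>
    (\<forall>(U, \<phi>)\<in>A. smooth_on (I \<inter> \<gamma> -` U) (\<phi> \<circ> \<gamma>))"

definition velocity :: "('a::topological_space, 'e::euclidean_space) chart set \<Rightarrow>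
    (real \<Rightarrow> 'a) \<Rightarrow> real \<Rightarrow> 'a tvec"
  where "velocity A \<gamma> s = (\<lambda>f. if smooth_near A (\<gamma> s) f then deriv (\<lambda>r. f (\<gamma> r)) s else 0)"

text \<open>The covariant derivative of a vector field \<open>V\<close> along \<open>\<gamma>\<close>: writing \<open>V = (\<Sum>b. V\<^sub>b \<partial>\<^sub>b)\<close> in a chart
  around \<open>\<gamma> s\<close>, with components \<open>V\<^sub>b = V(x\<^sub>b)\<close>, it is \<open>\<Sum>b. V\<^sub>b'(s) \<partial>\<^sub>b + V\<^sub>b(s) \<nabla>\<^bsub>\<gamma>'(s)\<^esub> \<partial>\<^sub>b\<close>. The result does not
  depend on the chart.\<close>

definition cov_deriv_in_chart :: "('a::topological_space, 'e::euclidean_space) chart set \<Rightarrow>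
    ('a, 'e) chart \<Rightarrow> 'a connection \<Rightarrow> (real \<Rightarrow> 'a) \<Rightarrow> (real \<Rightarrow> 'a tvec) \<Rightarrow> real \<Rightarrow> 'a tvec"
  where "cov_deriv_in_chart A c nab \<gamma> V s = (\<Sum>b\<in>Basis.
    deriv (\<lambda>r. V r (\<lambda>q. snd c q \<bullet> b)) s *\<^sub>R coord_vec A c (\<gamma> s) b
    + V s (\<lambda>q. snd c q \<bullet> b) *\<^sub>R nab (\<gamma> s) (velocity A \<gamma> s) (\<lambda>q. coord_vec A c q b))"

definition cov_deriv_along :: "('a::topological_space, 'e::euclidean_space) chart set \<Rightarrow>
    'a connection \<Rightarrow> (real \<Rightarrow> 'a) \<Rightarrow> (real \<Rightarrow> 'a tvec) \<Rightarrow> real \<Rightarrow> 'a tvec"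
  where "cov_deriv_along A nab \<gamma> V s =
    cov_deriv_in_chart A (SOME c. c \<in> A \<and> \<gamma> s \<in> fst c) nab \<gamma> V s"

definition geodesic_on :: "('a::topological_space, 'e::euclidean_space) chart set \<Rightarrow>
    'a connection \<Rightarrow> real set \<Rightarrow> (real \<Rightarrow> 'a) \<Rightarrow> bool"
  where "geodesic_on A nab I \<gamma> \<longleftrightarrow> smooth_curve A I \<gamma> \<and>
    (\<forall>s\<in>I. cov_deriv_along A nab \<gamma> (velocity A \<gamma>) s = 0)"

subsection \<open>Standard stationary spacetimes\<close>

definition line_prod :: "('a::topological_space, 'e::euclidean_space) chart set \<Rightarrow>
    (real \<times> 'a, real \<times> 'e) chart set"
  where "line_prod A = (\<lambda>(U, \<phi>). (UNIV \<times> U, map_prod id \<phi>)) ` A"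

text \<open>The bilinear form obtained by polarization from
  \<open>(\<tau>, v) \<mapsto> - \<beta> \<tau>\<^sup>2 + \<langle>v, v\<rangle> + 2 \<tau> \<langle>\<delta>, v\<rangle>\<close>, where \<open>\<tau> = dt(u) = u(fst)\<close> and \<open>v\<close> is the projection of
  \<open>u\<close> to the second factor.\<close>

definition stationary_metric :: "('a::topological_space, 'e::euclidean_space) chart set \<Rightarrow>
    'a metric_tensor \<Rightarrow> ('a \<Rightarrow> real) \<Rightarrow> ('a \<Rightarrow> 'a tvec) \<Rightarrow> (real \<times> 'a) metric_tensor"
  where "stationary_metric A g \<beta> \<delta> p u w =
    (let x = snd p; u\<^sub>0 = differential A snd p u; w\<^sub>0 = differential A snd p w
     in - \<beta> x * u fst * w fst + g x u\<^sub>0 w\<^sub>0 + u fst * g x (\<delta> x) w\<^sub>0 + w fst * g x (\<delta> x) u\<^sub>0)"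

definition partial_t :: "('a::topological_space, 'e::euclidean_space) chart set \<Rightarrow>
    real \<times> 'a \<Rightarrow> (real \<times> 'a) tvec"
  where "partial_t A p = velocity (line_prod A) (\<lambda>r. (r, snd p)) (fst p)"

definition standard_stationary :: "('a::topological_space, 'e::euclidean_space) chart set \<Rightarrow>
    'a metric_tensor \<Rightarrow> ('a \<Rightarrow> real) \<Rightarrow> ('a \<Rightarrow> 'a tvec) \<Rightarrow> bool"
  where "standard_stationary A g \<beta> \<delta> \<longleftrightarrow> smooth_atlas A \<and> riemannian_metric A g \<and>
    smooth_fun_on A UNIV \<beta> \<and> (\<forall>p. \<beta> p > 0) \<and> smooth_vf_on A UNIV \<delta>"

subsection \<open>The tensors in the equation for the spatial part\<close>

definition nab_form :: "'a metric_tensor \<Rightarrow> 'a connection \<Rightarrow> ('a \<Rightarrow> 'a tvec) \<Rightarrow>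
    'a \<Rightarrow> 'a tvec \<Rightarrow> 'a tvec \<Rightarrow> real"
  where "nab_form g nab \<delta> p v w = g p (nab p v \<delta>) w"

definition sym_nab :: "'a metric_tensor \<Rightarrow> 'a connection \<Rightarrow> ('a \<Rightarrow> 'a tvec) \<Rightarrow>
    'a \<Rightarrow> 'a tvec \<Rightarrow> 'a tvec \<Rightarrow> real"
  where "sym_nab g nab \<delta> p v w = 1/2 * (nab_form g nab \<delta> p v w + nab_form g nab \<delta> p w v)"

definition rot :: "'a metric_tensor \<Rightarrow> 'a connection \<Rightarrow> ('a \<Rightarrow> 'a tvec) \<Rightarrow>
    'a \<Rightarrow> 'a tvec \<Rightarrow> 'a tvec \<Rightarrow> real"
  where "rot g nab \<delta> p v w = nab_form g nab \<delta> p v w - nab_form g nab \<delta> p w v"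

definition Lam :: "'a metric_tensor \<Rightarrow> ('a \<Rightarrow> real) \<Rightarrow> ('a \<Rightarrow> 'a tvec) \<Rightarrow> 'a \<Rightarrow> real"
  where "Lam g \<beta> \<delta> p = - 1 / (\<beta> p + (metric_norm g p (\<delta> p))\<^sup>2)"

definition R0 :: "('a::topological_space, 'e::euclidean_space) chart set \<Rightarrow>
    'a metric_tensor \<Rightarrow> ('a \<Rightarrow> real) \<Rightarrow> ('a \<Rightarrow> 'a tvec) \<Rightarrow> 'a \<Rightarrow> 'a tvec"
  where "R0 A g \<beta> \<delta> p =
    (- 1/2) *\<^sub>R ((Lam g \<beta> \<delta> p * g p (\<delta> p) (grad A g \<beta> p)) *\<^sub>R \<delta> p + grad A g \<beta> p)"

definition R1 :: "('a::topological_space, 'e::euclidean_space) chart set \<Rightarrow> 'a metric_tensor \<Rightarrow>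
    'a connection \<Rightarrow> ('a \<Rightarrow> real) \<Rightarrow> ('a \<Rightarrow> 'a tvec) \<Rightarrow> 'a \<Rightarrow> 'a tvec \<Rightarrow> 'a tvec"
  where "R1 A g nab \<beta> \<delta> p v =
    (- Lam g \<beta> \<delta> p * (g p (grad A g \<beta> p) v + rot g nab \<delta> p v (\<delta> p))) *\<^sub>R \<delta> p
    + sharp A g p (\<lambda>y. rot g nab \<delta> p y v)"

definition R2 :: "'a metric_tensor \<Rightarrow> 'a connection \<Rightarrow> ('a \<Rightarrow> real) \<Rightarrow> ('a \<Rightarrow> 'a tvec) \<Rightarrow>
    'a \<Rightarrow> 'a tvec \<Rightarrow> 'a tvec \<Rightarrow> 'a tvec"
  where "R2 g nab \<beta> \<delta> p v w = (Lam g \<beta> \<delta> p * sym_nab g nab \<delta> p v w) *\<^sub>R \<delta> p"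

definition R0_bar :: "('a::topological_space, 'e::euclidean_space) chart set \<Rightarrow>
    'a metric_tensor \<Rightarrow> ('a \<Rightarrow> real) \<Rightarrow> ('a \<Rightarrow> 'a tvec) \<Rightarrow> real \<Rightarrow> 'a \<Rightarrow> 'a tvec"
  where "R0_bar A g \<beta> \<delta> E p = (E\<^sup>2 / (\<beta> p)\<^sup>2) *\<^sub>R R0 A g \<beta> \<delta> p"

definition R1_bar :: "('a::topological_space, 'e::euclidean_space) chart set \<Rightarrow>
    'a metric_tensor \<Rightarrow> 'a connection \<Rightarrow> ('a \<Rightarrow> real) \<Rightarrow> ('a \<Rightarrow> 'a tvec) \<Rightarrow> real \<Rightarrow>
    'a \<Rightarrow> 'a tvec \<Rightarrow> 'a tvec"
  where "R1_bar A g nab \<beta> \<delta> E p v =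
    (- (E / \<beta> p)) *\<^sub>R ((2 * (g p (\<delta> p) v / \<beta> p)) *\<^sub>R R0 A g \<beta> \<delta> p + R1 A g nab \<beta> \<delta> p v)"

definition R2_bar :: "('a::topological_space, 'e::euclidean_space) chart set \<Rightarrow>
    'a metric_tensor \<Rightarrow> 'a connection \<Rightarrow> ('a \<Rightarrow> real) \<Rightarrow> ('a \<Rightarrow> 'a tvec) \<Rightarrow>
    'a \<Rightarrow> 'a tvec \<Rightarrow> 'a tvec"
  where "R2_bar A g nab \<beta> \<delta> p v =
    ((g p (\<delta> p) v)\<^sup>2 / (\<beta> p)\<^sup>2) *\<^sub>R R0 A g \<beta> \<delta> p
    + (g p (\<delta> p) v / \<beta> p) *\<^sub>R R1 A g nab \<beta> \<delta> p v + R2 g nab \<beta> \<delta> p v v"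

end

theory Submission
  imports Defs
begin

text \<open>
  For a coordinate field \<open>Z\<close> and the field \<open>V\<close> with constant components that extends \<open>\<gamma>'(s)\<close>, metric
  compatibility and \<open>\<nabla>\<^sub>V Z = \<nabla>\<^sub>Z V\<close> turn \<open>\<langle>\<nabla>\<^bsub>\<gamma>'\<^esub>\<gamma>', Z\<rangle>\<close> into the Euler-Lagrange expression
  \<open>d/ds \<langle>\<gamma>', Z\<rangle> - 1/2 Z\<langle>V, V\<rangle>\<close>. Evaluating it for the Lorentz metric in a product chart and subtracting
  the same expression for the Riemannian metric shows that the product of \<open>\<nabla>\<^bsub>\<gamma>'\<^esub>\<gamma>'\<close> with \<open>\<partial>\<^sub>t\<close> is \<open>E'\<close>,
  and that its products with spatial vectors are those of
  \<open>\<nabla>\<^bsub>x'\<^esub>x' + t'' \<delta> - t' rot \<delta>(\<cdot>, x')\<^sup>\<sharp> + 1/2 t'\<^sup>2 \<nabla>\<beta>\<close>. Since the Lorentz metric is nondegenerate,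
  \<open>\<gamma>\<close> is a geodesic iff all of these vanish; \<open>E' = 0\<close> is then used to eliminate \<open>t'\<close> and \<open>t''\<close>.
\<close>

subsection \<open>Calculus of smooth functions\<close>

text \<open>The obstacle is that \<open>cov_deriv_along\<close> is computed in an arbitrarily chosen
  chart, and the choices made for the spacetime and for its spatial factor are unrelated. Instead of
  transforming Christoffel symbols, the proof knows a covariant derivative by its products with
  fields Z: the derivative of the product of the velocity with Z is the product of the covariant
  derivative with Z plus a term free of charts, so uniqueness of real derivatives makes results from
  different charts comparable. The connections are given by their axioms alone. Torsion-freeness on
  commuting coordinate fields, which rests on the symmetry of second derivatives, takes the place of
  the Koszul formula. The product with the time direction is E' because the Lorentz coefficients in
  a product chart are functions on the spatial factor and do not depend on t. The equivalence is
  first proved at each s, with the energy at that s in the role of E; the interval then makes E one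
  constant. Tangent vectors are operators with value 0 on functions that are not smooth, so every
  differentiation carries a smoothness condition.\<close>

lemma Ck_on_subset: "Ck_on k S f \<Longrightarrow> T \<subseteq> S \<Longrightarrow> Ck_on k T f"
  by (induction k arbitrary: f) (auto intro: continuous_on_subset)

text \<open>The product and chain rules mention the function next to its derivative, so a function
  of class k+1 must also be of class k; the recursion of \<open>Ck_on\<close> does not list
  this.\<close>

lemma Ck_on_SucD: "Ck_on (Suc k) S f \<Longrightarrow> Ck_on k S f"
proof (induction k arbitrary: f)
  case 0
  then have "f differentiable_on S"
    by (auto simp: differentiable_on_def intro: differentiable_at_withinI)
  then show ?case
    by (simp add: differentiable_imp_continuous_on)
next
  case (Suc k)
  have "\<forall>x\<in>S. f differentiable at x" "\<And>v. Ck_on (Suc k) S (\<lambda>x. frechet_derivative f (at x) v)"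
    using Suc.prems by simp_all
  then show ?case
    using Suc.IH by simp
qed

text \<open>Openness makes this true, since \<open>frechet_derivative\<close> looks at a whole
  neighbourhood. It is used constantly because \<open>inv_into\<close> is arbitrary off the image of
  a chart, so coordinate identities hold only there.\<close>

lemma Ck_on_cong:
  assumes "open S" "Ck_on k S f" "\<And>x. x \<in> S \<Longrightarrow> f x = h x"
  shows "Ck_on k S h"
  using assms(2,3)
proof (induction k arbitrary: f h)
  case 0
  then show ?case by (simp cong: continuous_on_cong)
next
  case (Suc k)
  have diff: "f differentiable at x" if "x \<in> S" for x
    using Suc.prems that by simp
  have eq: "frechet_derivative f (at x) = frechet_derivative h (at x)" if "x \<in> S" for x
    using frechet_derivative_transform_within_open[OF diff[OF that] \<open>open S\<close> that] Suc.prems by simp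
  have "h differentiable at x" if "x \<in> S" for x
    using diff[OF that] frechet_derivative_works has_derivative_transform_within_open[of f _ x UNIV S h]
      Suc.prems(2) that \<open>open S\<close>
    by (metis differentiable_def)
  moreover have "Ck_on k S (\<lambda>x. frechet_derivative h (at x) v)" for v
    by (rule Suc.IH[where f="\<lambda>x. frechet_derivative f (at x) v"]) (use Suc.prems eq in auto)
  ultimately show ?case by simp
qed

text \<open>Lets a differentiation rule supply the derivative as an explicit term; uniqueness of
  derivatives identifies it with the \<open>frechet_derivative\<close> of the definition.\<close>

lemma Ck_on_SucI:
  assumes "open S" "\<And>x. x \<in> S \<Longrightarrow> (f has_derivative f' x) (at x)"
    and "\<And>v. Ck_on k S (\<lambda>x. f' x v)"
  shows "Ck_on (Suc k) S f"
proof -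
  have "Ck_on k S (\<lambda>x. frechet_derivative f (at x) v)" for v
    by (rule Ck_on_cong[OF assms(1) assms(3)[of v]]) (simp add: frechet_derivative_at[OF assms(2), symmetric])
  then show ?thesis
    using assms(2) by (auto simp: differentiable_def)
qed

lemma Ck_on_has_derivative:
  "Ck_on (Suc k) S f \<Longrightarrow> x \<in> S \<Longrightarrow> (f has_derivative frechet_derivative f (at x)) (at x)"
  by (simp add: frechet_derivative_works)

lemma Ck_on_const: "open S \<Longrightarrow> Ck_on k S (\<lambda>x. c)"
  by (induction k arbitrary: c) auto

lemma Ck_on_add:
  assumes "open S"
  shows "Ck_on k S f \<Longrightarrow> Ck_on k S h \<Longrightarrow> Ck_on k S (\<lambda>x. f x + h x)"
proof (induction k arbitrary: f h)
  case 0
  then show ?case by (simp add: continuous_on_add)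
next
  case (Suc k)
  show ?case
  proof (rule Ck_on_SucI[OF assms])
    show "((\<lambda>x. f x + h x) has_derivative
        (\<lambda>v. frechet_derivative f (at x) v + frechet_derivative h (at x) v)) (at x)" if "x \<in> S" for x
      using Suc.prems that by (intro has_derivative_add Ck_on_has_derivative) auto
    show "Ck_on k S (\<lambda>x. frechet_derivative f (at x) v + frechet_derivative h (at x) v)" for v
      using Suc by simp
  qed
qed

lemma Ck_on_bounded_linear:
  assumes "open S" "bounded_linear L"
  shows "Ck_on k S f \<Longrightarrow> Ck_on k S (\<lambda>x. L (f x))"
proof (induction k arbitrary: f)
  case 0
  then show ?case
    using bounded_linear.continuous_on[OF assms(2)] by simp
next
  case (Suc k)
  show ?case
  proof (rule Ck_on_SucI[OF assms(1)])
    show "((\<lambda>x. L (f x)) has_derivative (\<lambda>v. L (frechet_derivative f (at x) v))) (at x)"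
      if "x \<in> S" for x
      using Suc.prems that by (intro bounded_linear.has_derivative[OF assms(2)] Ck_on_has_derivative) auto
    show "Ck_on k S (\<lambda>x. L (frechet_derivative f (at x) v))" for v
      using Suc by simp
  qed
qed

lemma Ck_on_scaleR:
  assumes "open S"
  shows "Ck_on k S f \<Longrightarrow> Ck_on k S h \<Longrightarrow> Ck_on k S (\<lambda>x. f x *\<^sub>R h x)"
proof (induction k arbitrary: f h)
  case 0
  then show ?case by (simp add: continuous_on_scaleR)
next
  case (Suc k)
  show ?case
  proof (rule Ck_on_SucI[OF assms])
    show "((\<lambda>x. f x *\<^sub>R h x) has_derivative
        (\<lambda>v. f x *\<^sub>R frechet_derivative h (at x) v + frechet_derivative f (at x) v *\<^sub>R h x)) (at x)"
      if "x \<in> S" for x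
      using Suc.prems that by (intro has_derivative_scaleR Ck_on_has_derivative) auto
    show "Ck_on k S (\<lambda>x. f x *\<^sub>R frechet_derivative h (at x) v + frechet_derivative f (at x) v *\<^sub>R h x)"
      for v
      using Suc Ck_on_SucD[of k S f] Ck_on_SucD[of k S h] by (intro Ck_on_add[OF assms] Suc.IH) auto
  qed
qed

lemma Ck_on_sum:
  assumes "open S"
  shows "(\<And>i. i \<in> F \<Longrightarrow> Ck_on k S (f i)) \<Longrightarrow> Ck_on k S (\<lambda>x. \<Sum>i\<in>F. f i x)"
  by (induction F rule: infinite_finite_induct)
    (simp_all add: Ck_on_const[OF assms] Ck_on_add[OF assms])

lemma Ck_on_compose:
  fixes h :: "'a::real_normed_vector \<Rightarrow> 'e::euclidean_space"
  assumes "open S" "open T" "h ` S \<subseteq> T"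
  shows "Ck_on k T f \<Longrightarrow> Ck_on k S h \<Longrightarrow> Ck_on k S (\<lambda>x. f (h x))"
proof (induction k arbitrary: f)
  case 0
  then show ?case
    using assms(3) by (auto intro: continuous_on_compose2)
next
  case (Suc k)
  show ?case
  proof (rule Ck_on_SucI[OF assms(1)])
    fix x assume x: "x \<in> S"
    then have hx: "h x \<in> T" using assms by auto
    let ?D = "frechet_derivative f (at (h x))" and ?d = "frechet_derivative h (at x)"
    have df: "(f has_derivative ?D) (at (h x))" and dh: "(h has_derivative ?d) (at x)"
      using Suc.prems x hx by (auto intro: Ck_on_has_derivative)
    \<comment> \<open>\<open>Ck_on\<close> controls a derivative only at a fixed vector, but
      \<open>?d v\<close> varies with \<open>x\<close>. Expansion in the basis turns the derivative
      into a finite sum of products of functions of class \<open>k\<close>; hence the Euclidean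
      target of \<open>h\<close>.\<close>
    have "?D (?d v) = (\<Sum>b\<in>Basis. (?d v \<bullet> b) *\<^sub>R ?D b)" for v
    proof -
      have lin: "linear ?D" using df has_derivative_linear by blast
      have "?D (?d v) = ?D (\<Sum>b\<in>Basis. (?d v \<bullet> b) *\<^sub>R b)"
        by (simp add: euclidean_representation)
      also have "\<dots> = (\<Sum>b\<in>Basis. (?d v \<bullet> b) *\<^sub>R ?D b)"
        using lin by (simp add: linear_sum linear_scale)
      finally show ?thesis .
    qed
    then show "((\<lambda>x. f (h x)) has_derivative (\<lambda>v. \<Sum>b\<in>Basis. (?d v \<bullet> b) *\<^sub>R ?D b)) (at x)"
      using has_derivative_compose[OF dh df] by simp
  next
    fix v
    have "Ck_on k S (\<lambda>x. frechet_derivative h (at x) v \<bullet> b)" for b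
      by (rule Ck_on_bounded_linear[OF assms(1) bounded_linear_inner_left]) (use Suc.prems(2) in simp)
    moreover have "Ck_on k S (\<lambda>x. frechet_derivative f (at (h x)) b)" for b
      using Suc.IH[of "\<lambda>y. frechet_derivative f (at y) b"] Suc.prems Ck_on_SucD by auto
    ultimately show "Ck_on k S (\<lambda>x. \<Sum>b\<in>Basis. (frechet_derivative h (at x) v \<bullet> b)
        *\<^sub>R frechet_derivative f (at (h x)) b)"
      by (intro Ck_on_sum[OF assms(1)] Ck_on_scaleR[OF assms(1)])
  qed
qed

lemma smooth_on_subset: "smooth_on S f \<Longrightarrow> T \<subseteq> S \<Longrightarrow> smooth_on T f"
  unfolding smooth_on_def using Ck_on_subset by blast

lemma smooth_on_cong:
  "open S \<Longrightarrow> smooth_on S f \<Longrightarrow> (\<And>x. x \<in> S \<Longrightarrow> f x = h x) \<Longrightarrow> smooth_on S h"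
  unfolding smooth_on_def using Ck_on_cong by blast

lemma smooth_on_const: "open S \<Longrightarrow> smooth_on S (\<lambda>x. c)"
  unfolding smooth_on_def by (simp add: Ck_on_const)

lemma smooth_on_add: "open S \<Longrightarrow> smooth_on S f \<Longrightarrow> smooth_on S h \<Longrightarrow> smooth_on S (\<lambda>x. f x + h x)"
  unfolding smooth_on_def by (simp add: Ck_on_add)

lemma smooth_on_scaleR:
  "open S \<Longrightarrow> smooth_on S f \<Longrightarrow> smooth_on S h \<Longrightarrow> smooth_on S (\<lambda>x. f x *\<^sub>R h x)"
  unfolding smooth_on_def by (simp add: Ck_on_scaleR)

lemma smooth_on_bounded_linear:
  "open S \<Longrightarrow> bounded_linear L \<Longrightarrow> smooth_on S f \<Longrightarrow> smooth_on S (\<lambda>x. L (f x))"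
  unfolding smooth_on_def by (simp add: Ck_on_bounded_linear)

lemma smooth_on_compose:
  fixes h :: "'a::real_normed_vector \<Rightarrow> 'e::euclidean_space"
  shows "open S \<Longrightarrow> open T \<Longrightarrow> h ` S \<subseteq> T \<Longrightarrow> smooth_on T f \<Longrightarrow> smooth_on S h \<Longrightarrow>
    smooth_on S (\<lambda>x. f (h x))"
  unfolding smooth_on_def by (simp add: Ck_on_compose)

lemma smooth_on_frechet_derivative: "smooth_on S f \<Longrightarrow> smooth_on S (\<lambda>x. frechet_derivative f (at x) v)"
  unfolding smooth_on_def by (metis Ck_on.simps(2))

lemma smooth_on_differentiable: "smooth_on S f \<Longrightarrow> x \<in> S \<Longrightarrow> f differentiable at x"
  unfolding smooth_on_def by (metis Ck_on.simps(2))

lemma smooth_on_continuous_on: "smooth_on S f \<Longrightarrow> continuous_on S f"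
  unfolding smooth_on_def by (metis Ck_on.simps(1))

lemma smooth_on_id: "open S \<Longrightarrow> smooth_on S (\<lambda>x. x)"
  unfolding smooth_on_def
proof
  fix k assume "open S"
  then show "Ck_on k S (\<lambda>x. x)"
    by (cases k) (auto simp: Ck_on_const)
qed

lemma smooth_on_Pair:
  assumes "open S" "smooth_on S f" "smooth_on S h"
  shows "smooth_on S (\<lambda>x. (f x, h x))"
proof -
  have 1: "bounded_linear (\<lambda>u. (u, 0))" and 2: "bounded_linear (\<lambda>u. (0, u))"
    by (auto intro: bounded_linear_Pair bounded_linear_ident bounded_linear_zero)
  show ?thesis
    using smooth_on_add[OF assms(1) smooth_on_bounded_linear[OF assms(1) 1 assms(2)]
        smooth_on_bounded_linear[OF assms(1) 2 assms(3)]] by simp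
qed

section \<open>Symmetry of mixed second derivatives\<close>

lemma second_difference_mvt:
  fixes f :: "'a::real_normed_vector \<Rightarrow> real"
  assumes S: "smooth_on S f" and h: "h > 0"
    and sub: "\<And>\<xi> \<eta>. 0 \<le> \<xi> \<Longrightarrow> \<xi> \<le> h \<Longrightarrow> 0 \<le> \<eta> \<Longrightarrow> \<eta> \<le> h \<Longrightarrow> p + \<xi> *\<^sub>R a + \<eta> *\<^sub>R b \<in> S"
  shows "\<exists>\<xi> \<eta>. 0 < \<xi> \<and> \<xi> < h \<and> 0 < \<eta> \<and> \<eta> < h \<and>
    f (p + h *\<^sub>R a + h *\<^sub>R b) - f (p + h *\<^sub>R a) - f (p + h *\<^sub>R b) + f p =
    h * h * frechet_derivative (\<lambda>y. frechet_derivative f (at y) a) (at (p + \<xi> *\<^sub>R a + \<eta> *\<^sub>R b)) b"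
proof -
  let ?Da = "\<lambda>y. frechet_derivative f (at y) a"
  have deriv: "((\<lambda>s. k (q + s *\<^sub>R v)) has_real_derivative frechet_derivative k (at (q + s *\<^sub>R v)) v) (at s)"
    if "smooth_on S k" "q + s *\<^sub>R v \<in> S" for k :: "'a \<Rightarrow> real" and q v s
  proof -
    have k: "(k has_derivative frechet_derivative k (at (q + s *\<^sub>R v))) (at (q + s *\<^sub>R v))"
      using smooth_on_differentiable[OF that] frechet_derivative_works by blast
    have "((\<lambda>s. k (q + s *\<^sub>R v)) has_derivative (\<lambda>r. frechet_derivative k (at (q + s *\<^sub>R v)) (r *\<^sub>R v))) (at s)"
      by (rule has_derivative_compose[where f="\<lambda>s. q + s *\<^sub>R v" and g=k, OF _ k]) (auto intro!: derivative_eq_intros)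
    then show ?thesis
      using linear_scale[OF has_derivative_linear[OF k]]
      by (simp add: has_field_derivative_def mult_commute_abs)
  qed
  \<comment> \<open>The second difference is a first difference of \<open>\<phi>\<close>. The mean
    value theorem is applied to \<open>\<phi>\<close> in direction \<open>a\<close>, then in
    direction \<open>b\<close> to the derivative so obtained.\<close>
  define \<phi> where "\<phi> s = f ((p + h *\<^sub>R b) + s *\<^sub>R a) - f (p + s *\<^sub>R a)" for s
  have d\<phi>: "(\<phi> has_real_derivative ?Da ((p + h *\<^sub>R b) + s *\<^sub>R a) - ?Da (p + s *\<^sub>R a)) (at s)"
    if "0 \<le> s" "s \<le> h" for s
    unfolding \<phi>_def using sub[of s h] sub[of s 0] that h
    by (intro DERIV_diff deriv S) (auto simp: add_ac)
  obtain \<xi> where \<xi>: "0 < \<xi>" "\<xi> < h"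
    "\<phi> h - \<phi> 0 = (h - 0) * (?Da ((p + h *\<^sub>R b) + \<xi> *\<^sub>R a) - ?Da (p + \<xi> *\<^sub>R a))"
    using MVT2[OF h d\<phi>] by blast
  obtain \<eta> where \<eta>: "0 < \<eta>" "\<eta> < h"
    "?Da ((p + \<xi> *\<^sub>R a) + h *\<^sub>R b) - ?Da ((p + \<xi> *\<^sub>R a) + 0 *\<^sub>R b)
      = (h - 0) * frechet_derivative ?Da (at ((p + \<xi> *\<^sub>R a) + \<eta> *\<^sub>R b)) b"
    using MVT2[OF h deriv[OF smooth_on_frechet_derivative[OF S]], of "p + \<xi> *\<^sub>R a" b] sub \<xi>
    by (metis less_eq_real_def)
  have "f (p + h *\<^sub>R a + h *\<^sub>R b) - f (p + h *\<^sub>R a) - f (p + h *\<^sub>R b) + f p = \<phi> h - \<phi> 0"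
    by (simp add: \<phi>_def add_ac)
  also have "\<dots> = h * h * frechet_derivative ?Da (at (p + \<xi> *\<^sub>R a + \<eta> *\<^sub>R b)) b"
    using \<xi>(3) \<eta>(3) by (simp add: add_ac)
  finally show ?thesis using \<xi>(1,2) \<eta>(1,2) by blast
qed

text \<open>The second difference over a small parallelogram is symmetric in \<open>a\<close> and
  \<open>b\<close>, and it is \<open>h * h\<close> times either mixed derivative at suitable points
  near \<open>p\<close>. Continuity then rules out a gap at \<open>p\<close>.\<close>

lemma frechet_derivative_commute:
  fixes f :: "'a::real_normed_vector \<Rightarrow> real"
  assumes "open S" "smooth_on S f" "p \<in> S"
  shows "frechet_derivative (\<lambda>y. frechet_derivative f (at y) a) (at p) b =
    frechet_derivative (\<lambda>y. frechet_derivative f (at y) b) (at p) a"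
    (is "?G a b p = ?G b a p")
proof (rule ccontr)
  assume ne: "?G a b p \<noteq> ?G b a p"
  \<comment> \<open>Half the gap: no number is closer than this to both mixed derivatives at
    \<open>p\<close>.\<close>
  define e where "e = \<bar>?G a b p - ?G b a p\<bar> / 2"
  have e: "e > 0" using ne by (simp add: e_def)
  have ev: "\<exists>d>0. \<forall>y. dist y p < d \<longrightarrow> y \<in> S \<and> \<bar>?G a b y - ?G a b p\<bar> < e" for a b
  proof -
    have "continuous_on S (?G a b)"
      using assms(2) by (intro smooth_on_continuous_on smooth_on_frechet_derivative)
    then obtain d where "d > 0" "\<And>y. y \<in> S \<Longrightarrow> dist y p < d \<Longrightarrow> dist (?G a b y) (?G a b p) < e"
      using assms(3) e unfolding continuous_on_iff by blast
    moreover obtain d' where "d' > 0" "ball p d' \<subseteq> S"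
      using assms(1,3) open_contains_ball by blast
    ultimately show ?thesis
      by (intro exI[of _ "min d d'"]) (auto simp: dist_real_def dist_commute subset_iff)
  qed
  obtain d1 where d1: "d1 > 0" "\<And>y. dist y p < d1 \<Longrightarrow> y \<in> S \<and> \<bar>?G a b y - ?G a b p\<bar> < e"
    using ev by blast
  obtain d2 where d2: "d2 > 0" "\<And>y. dist y p < d2 \<Longrightarrow> y \<in> S \<and> \<bar>?G b a y - ?G b a p\<bar> < e"
    using ev by blast
  define d where "d = min d1 d2"
  \<comment> \<open>Small enough for the whole parallelogram with sides \<open>h *\<^sub>R a\<close>
    and \<open>h *\<^sub>R b\<close> to stay within \<open>d\<close> of \<open>p\<close>; the
    summand 1 keeps the denominator positive.\<close>
  define h where "h = d / (2 * (norm a + norm b + 1))"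
  have pos: "norm a + norm b + 1 > 0"
    by (smt (verit) norm_ge_zero)
  have h: "h > 0"
    using d1 d2 pos by (simp add: h_def d_def)
  have half: "2 * (d / (2 * N) * N) = d" if "N > 0" for N :: real
    using that by simp
  have close: "dist (p + \<xi> *\<^sub>R a + \<eta> *\<^sub>R b) p < d"
    if "0 \<le> \<xi>" "\<xi> \<le> h" "0 \<le> \<eta>" "\<eta> \<le> h" for \<xi> \<eta> :: real
  proof -
    have "dist (p + \<xi> *\<^sub>R a + \<eta> *\<^sub>R b) p = norm (\<xi> *\<^sub>R a + \<eta> *\<^sub>R b)"
      by (simp add: dist_norm)
    also have "\<dots> \<le> \<xi> * norm a + \<eta> * norm b"
      using norm_triangle_ineq[of "\<xi> *\<^sub>R a" "\<eta> *\<^sub>R b"] that by simp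
    also have "\<dots> \<le> h * norm a + h * norm b"
      using that by (intro add_mono mult_right_mono) auto
    also have "\<dots> < 2 * (h * (norm a + norm b + 1))"
      using h by (simp add: algebra_simps add_strict_increasing2)
    also have "\<dots> = d"
      unfolding h_def using half[OF pos] .
    finally show ?thesis .
  qed
  have inS: "p + \<xi> *\<^sub>R a + \<eta> *\<^sub>R b \<in> S"
    if "0 \<le> \<xi>" "\<xi> \<le> h" "0 \<le> \<eta>" "\<eta> \<le> h" for \<xi> \<eta>
    using close[OF that] d1 by (simp add: d_def)
  have inS': "p + \<xi> *\<^sub>R b + \<eta> *\<^sub>R a \<in> S"
    if "0 \<le> \<xi>" "\<xi> \<le> h" "0 \<le> \<eta>" "\<eta> \<le> h" for \<xi> \<eta>
    using inS[OF that(3,4,1,2)] by (simp add: add_ac)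
  obtain \<xi> \<eta> where 1: "0 < \<xi>" "\<xi> < h" "0 < \<eta>" "\<eta> < h"
    "f (p + h *\<^sub>R a + h *\<^sub>R b) - f (p + h *\<^sub>R a) - f (p + h *\<^sub>R b) + f p
      = h * h * ?G a b (p + \<xi> *\<^sub>R a + \<eta> *\<^sub>R b)"
    using second_difference_mvt[OF assms(2) h inS] by blast
  obtain \<xi>' \<eta>' where 2: "0 < \<xi>'" "\<xi>' < h" "0 < \<eta>'" "\<eta>' < h"
    "f (p + h *\<^sub>R b + h *\<^sub>R a) - f (p + h *\<^sub>R b) - f (p + h *\<^sub>R a) + f p
      = h * h * ?G b a (p + \<xi>' *\<^sub>R b + \<eta>' *\<^sub>R a)"
    using second_difference_mvt[OF assms(2) h inS'] by blast
  have swap: "p + h *\<^sub>R b + h *\<^sub>R a = p + h *\<^sub>R a + h *\<^sub>R b"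
    by (simp add: add_ac)
  have "h * h * ?G a b (p + \<xi> *\<^sub>R a + \<eta> *\<^sub>R b) = h * h * ?G b a (p + \<xi>' *\<^sub>R b + \<eta>' *\<^sub>R a)"
    using 1(5) 2(5)[unfolded swap] by linarith
  then have "?G a b (p + \<xi> *\<^sub>R a + \<eta> *\<^sub>R b) = ?G b a (p + \<eta>' *\<^sub>R a + \<xi>' *\<^sub>R b)"
    using h by (simp add: add_ac)
  moreover have "\<bar>?G a b (p + \<xi> *\<^sub>R a + \<eta> *\<^sub>R b) - ?G a b p\<bar> < e"
    using close[of \<xi> \<eta>] 1 d1 by (simp add: d_def)
  moreover have "\<bar>?G b a (p + \<eta>' *\<^sub>R a + \<xi>' *\<^sub>R b) - ?G b a p\<bar> < e"
    using close[of \<eta>' \<xi>'] 2 d2 by (simp add: d_def)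
  ultimately show False
    by (simp add: e_def abs_if split: if_splits)
qed

subsection \<open>Tangent vectors and velocities in charts\<close>

locale smooth_manifold =
  fixes A :: "('a::topological_space, 'e::euclidean_space) chart set"
  assumes atlas: "smooth_atlas A"
begin

abbreviation chart_inv :: "('a, 'e) chart \<Rightarrow> 'e \<Rightarrow> 'a"
  where "chart_inv c \<equiv> inv_into (fst c) (snd c)"

lemma chart_at:
  obtains c where "c \<in> A" "p \<in> fst c"
proof -
  have "p \<in> (\<Union>(U, \<phi>)\<in>A. U)"
    using atlas by (auto simp: smooth_atlas_def)
  then show ?thesis using that by force
qed

lemma
  assumes "c \<in> A"
  shows open_chart: "open (fst c)"
    and open_chart_image: "open (snd c ` fst c)"
    and homeomorphism_chart: "homeomorphism (fst c) (snd c ` fst c) (snd c) (chart_inv c)"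
  using atlas assms unfolding smooth_atlas_def case_prod_unfold by blast+

lemma inj_on_chart: "c \<in> A \<Longrightarrow> inj_on (snd c) (fst c)"
  by (rule inj_on_inverseI[where g="chart_inv c"]) (rule homeomorphism_apply1[OF homeomorphism_chart])

lemma chart_inv_chart [simp]: "c \<in> A \<Longrightarrow> p \<in> fst c \<Longrightarrow> chart_inv c (snd c p) = p"
  using inj_on_chart by (rule inv_into_f_f)

lemma open_chart_image_Int:
  assumes "c \<in> A" "open W"
  shows "open (snd c ` (W \<inter> fst c))"
proof -
  have "openin (top_of_set (fst c)) (W \<inter> fst c)"
    using assms(2) by (subst Int_commute) (rule openin_open_Int)
  then have "openin (top_of_set (snd c ` fst c)) (snd c ` (W \<inter> fst c))"
    by (rule homeomorphism_imp_open_map[OF homeomorphism_chart[OF assms(1)]])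
  then show ?thesis
    using open_chart_image[OF assms(1)] openin_open_trans by blast
qed

lemma smooth_on_transition:
  "c \<in> A \<Longrightarrow> d \<in> A \<Longrightarrow> smooth_on (snd c ` (fst c \<inter> fst d)) (snd d \<circ> chart_inv c)"
  using atlas unfolding smooth_atlas_def case_prod_unfold by blast

section \<open>Smooth functions in charts\<close>

lemma smooth_fun_on_chartD:
  "smooth_fun_on A W f \<Longrightarrow> c \<in> A \<Longrightarrow> smooth_on (snd c ` (W \<inter> fst c)) (f \<circ> chart_inv c)"
  unfolding smooth_fun_on_def case_prod_unfold by blast

text \<open>One chart suffices: in any other chart the representation is the given one composed with
  a smooth transition map.\<close>

lemma smooth_fun_on_chartI:
  assumes c: "c \<in> A" and W: "open W" "W \<subseteq> fst c" and f: "smooth_on (snd c ` W) (f \<circ> chart_inv c)"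
  shows "smooth_fun_on A W f"
proof -
  have "smooth_on (snd d ` (W \<inter> fst d)) (f \<circ> chart_inv d)" if d: "d \<in> A" for d
  proof -
    let ?S = "snd d ` (W \<inter> fst d)"
    have S: "open ?S" using open_chart_image_Int[OF d W(1)] .
    have T: "open (snd c ` W)" using open_chart_image_Int[OF c W(1)] W(2) by (simp add: Int_absorb2)
    have h: "smooth_on ?S (snd c \<circ> chart_inv d)"
      by (rule smooth_on_subset[OF smooth_on_transition[OF d c]]) (use W in auto)
    have "smooth_on ?S (\<lambda>y. (f \<circ> chart_inv c) ((snd c \<circ> chart_inv d) y))"
      by (rule smooth_on_compose[OF S T _ f h]) (use d in auto)
    then show ?thesis
      by (rule smooth_on_cong[OF S]) (use d c W in auto)
  qed
  then show ?thesis
    unfolding smooth_fun_on_def case_prod_unfold by blast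
qed

lemma smooth_fun_on_subset: "smooth_fun_on A W f \<Longrightarrow> V \<subseteq> W \<Longrightarrow> smooth_fun_on A V f"
  unfolding smooth_fun_on_def case_prod_unfold using smooth_on_subset by (metis Int_mono image_mono order_refl)

lemma smooth_nearI: "smooth_fun_on A W f \<Longrightarrow> open W \<Longrightarrow> p \<in> W \<Longrightarrow> smooth_near A p f"
  unfolding smooth_near_def by blast

lemma smooth_nearE:
  assumes "smooth_near A p f" "c \<in> A" "p \<in> fst c"
  obtains W where "open W" "p \<in> W" "W \<subseteq> fst c" "open (snd c ` W)"
    "smooth_on (snd c ` W) (f \<circ> chart_inv c)" "smooth_fun_on A W f"
proof -
  obtain W where W: "open W" "p \<in> W" "smooth_fun_on A W f"
    using assms(1) unfolding smooth_near_def by blast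
  show ?thesis
  proof (rule that)
    show "open (W \<inter> fst c)" using W(1) open_chart[OF assms(2)] by (rule open_Int)
    show "open (snd c ` (W \<inter> fst c))" by (rule open_chart_image_Int[OF assms(2) W(1)])
    show "smooth_on (snd c ` (W \<inter> fst c)) (f \<circ> chart_inv c)"
      by (rule smooth_fun_on_chartD[OF W(3) assms(2)])
    show "smooth_fun_on A (W \<inter> fst c) f" by (rule smooth_fun_on_subset[OF W(3)]) simp
  qed (use W assms in auto)
qed

lemma smooth_nearI_chart:
  assumes "c \<in> A" "p \<in> W" "open W" "W \<subseteq> fst c" "smooth_on (snd c ` W) (f \<circ> chart_inv c)"
  shows "smooth_near A p f"
  by (rule smooth_nearI[OF smooth_fun_on_chartI]) (fact assms)+

text \<open>Smoothness near a point depends on the germ only. Because tangent vectors are 0 on other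
  functions, this settles which case applies when a function is replaced by one that agrees with it
  nearby.\<close>

lemma smooth_near_cong:
  assumes "smooth_near A p f" "open W" "p \<in> W" "\<And>q. q \<in> W \<Longrightarrow> f q = h q"
  shows "smooth_near A p h"
proof -
  obtain c where c: "c \<in> A" "p \<in> fst c" by (rule chart_at)
  obtain V where V: "open V" "p \<in> V" "V \<subseteq> fst c" "smooth_on (snd c ` V) (f \<circ> chart_inv c)"
    by (rule smooth_nearE[OF assms(1) c])
  show ?thesis
  proof (rule smooth_nearI_chart[OF c(1), of _ "V \<inter> W"])
    have "snd c ` (V \<inter> W) = snd c ` (V \<inter> W \<inter> fst c)" using V by auto
    then have "open (snd c ` (V \<inter> W))"
      using open_chart_image_Int[OF c(1), of "V \<inter> W"] V assms by auto
    then show "smooth_on (snd c ` (V \<inter> W)) (h \<circ> chart_inv c)"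
      by (rule smooth_on_cong[OF _ smooth_on_subset[OF V(4)]]) (use V c assms in auto)
  qed (use V assms in auto)
qed

lemma smooth_near_const: "smooth_near A p (\<lambda>q. r)"
proof -
  obtain c where c: "c \<in> A" "p \<in> fst c" by (rule chart_at)
  show ?thesis
    using smooth_nearI_chart[OF c open_chart[OF c(1)] order_refl, of "\<lambda>q. r"]
      smooth_on_const[OF open_chart_image[OF c(1)], of r] by (simp add: o_def)
qed

lemma
  assumes "smooth_near A p f" "smooth_near A p h"
  shows smooth_near_add: "smooth_near A p (\<lambda>q. f q + h q)"
    and smooth_near_mult: "smooth_near A p (\<lambda>q. f q * h q)"
proof -
  obtain c where c: "c \<in> A" "p \<in> fst c" by (rule chart_at)
  obtain V where V: "open V" "p \<in> V" "V \<subseteq> fst c" "smooth_on (snd c ` V) (f \<circ> chart_inv c)"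
    by (rule smooth_nearE[OF assms(1) c])
  obtain W where W: "open W" "p \<in> W" "W \<subseteq> fst c" "smooth_on (snd c ` W) (h \<circ> chart_inv c)"
    by (rule smooth_nearE[OF assms(2) c])
  have "snd c ` (V \<inter> W) = snd c ` (V \<inter> W \<inter> fst c)" using V by auto
  then have op: "open (snd c ` (V \<inter> W))"
    using open_chart_image_Int[OF c(1), of "V \<inter> W"] V W by auto
  have f: "smooth_on (snd c ` (V \<inter> W)) (f \<circ> chart_inv c)"
    and h: "smooth_on (snd c ` (V \<inter> W)) (h \<circ> chart_inv c)"
    using V(4) W(4) by (auto intro: smooth_on_subset)
  show "smooth_near A p (\<lambda>q. f q + h q)"
    by (rule smooth_nearI_chart[OF c(1), of _ "V \<inter> W"])
      (use V W smooth_on_add[OF op f h] in \<open>auto simp: o_def\<close>)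
  show "smooth_near A p (\<lambda>q. f q * h q)"
    by (rule smooth_nearI_chart[OF c(1), of _ "V \<inter> W"])
      (use V W smooth_on_scaleR[OF op f h] in \<open>auto simp: o_def\<close>)
qed

lemma smooth_near_cmult: "smooth_near A p f \<Longrightarrow> smooth_near A p (\<lambda>q. r * f q)"
  by (intro smooth_near_mult smooth_near_const)

section \<open>Coordinate vectors and the tangent space\<close>

lemma smooth_near_has_derivative:
  assumes "smooth_near A p f" "c \<in> A" "p \<in> fst c"
  shows "((f \<circ> chart_inv c) has_derivative (\<lambda>a. coord_vec A c p a f)) (at (snd c p))"
proof -
  obtain W where "p \<in> W" "smooth_on (snd c ` W) (f \<circ> chart_inv c)"
    by (rule smooth_nearE[OF assms])
  then have "(f \<circ> chart_inv c) differentiable at (snd c p)"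
    using smooth_on_differentiable by blast
  then show ?thesis
    using assms(1) by (simp add: coord_vec_def frechet_derivative_works)
qed

text \<open>The working rule for evaluating a tangent vector: exhibit any derivative in the chart.
  Smoothness has to come along, since otherwise the default value 0 applies.\<close>

lemma coord_vec_eqI:
  assumes "smooth_near A p f" "c \<in> A" "p \<in> fst c"
    and "((f \<circ> chart_inv c) has_derivative D) (at (snd c p))"
  shows "coord_vec A c p a f = D a"
  using has_derivative_unique[OF smooth_near_has_derivative[OF assms(1-3)] assms(4)] by meson

lemma coord_vec_not_smooth: "\<not> smooth_near A p f \<Longrightarrow> coord_vec A c p a f = 0"
  by (simp add: coord_vec_def)

text \<open>This is an identity of operators, so it also concerns functions that are not smooth;
  there all terms are 0.\<close>

lemma linear_coord_vec:
  assumes "c \<in> A" "p \<in> fst c"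
  shows "linear (coord_vec A c p)"
proof (rule linearI; rule ext)
  fix a b r f
  show "coord_vec A c p (a + b) f = (coord_vec A c p a + coord_vec A c p b) f"
    by (cases "smooth_near A p f")
      (auto simp: coord_vec_not_smooth linear_add[OF has_derivative_linear[OF smooth_near_has_derivative[OF _ assms]]])
  show "coord_vec A c p (r *\<^sub>R b) f = (r *\<^sub>R coord_vec A c p b) f"
    by (cases "smooth_near A p f")
      (auto simp: scaleR_fun_def coord_vec_not_smooth linear_scale[OF has_derivative_linear[OF smooth_near_has_derivative[OF _ assms]]])
qed

text \<open>By the chain rule, the new components are the Jacobian of the transition map applied to
  \<open>a\<close>.\<close>

lemma coord_vec_change_chart:
  assumes "c \<in> A" "d \<in> A" "p \<in> fst c" "p \<in> fst d"
  shows "\<exists>b. coord_vec A d p a = coord_vec A c p b"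
proof -
  let ?h = "snd c \<circ> chart_inv d"
  let ?S = "snd d ` (fst d \<inter> fst c)"
  have S: "open ?S"
    using open_chart_image_Int[OF assms(2) open_chart[OF assms(1)]] by (simp add: Int_commute)
  have pS: "snd d p \<in> ?S" using assms by auto
  have h: "(?h has_derivative frechet_derivative ?h (at (snd d p))) (at (snd d p))"
    using smooth_on_differentiable[OF smooth_on_transition[OF assms(2,1)] pS] frechet_derivative_works
    by blast
  have "coord_vec A d p a f = coord_vec A c p (frechet_derivative ?h (at (snd d p)) a) f" for f
  proof (cases "smooth_near A p f")
    case True
    have f: "((f \<circ> chart_inv c) has_derivative (\<lambda>a. coord_vec A c p a f)) (at (?h (snd d p)))"
      using smooth_near_has_derivative[OF True assms(1,3)] assms by simp
    have "(f \<circ> chart_inv c \<circ> ?h has_derivative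
        (\<lambda>a. coord_vec A c p a f) \<circ> frechet_derivative ?h (at (snd d p))) (at (snd d p))"
      by (rule diff_chain_at[OF h f])
    then have "(f \<circ> chart_inv d has_derivative
        (\<lambda>a. coord_vec A c p a f) \<circ> frechet_derivative ?h (at (snd d p))) (at (snd d p))"
      by (rule has_derivative_transform_within_open[OF _ S pS]) (use assms in auto)
    from coord_vec_eqI[OF True assms(2,4) this] show ?thesis by simp
  qed (simp add: coord_vec_not_smooth)
  then show ?thesis by blast
qed

text \<open>Replaces the union over all charts at \<open>p\<close> by the image of one linear map.
  Hence the tangent space is a subspace, and each proof may pick its own chart.\<close>

lemma tangent_space_eq:
  assumes "c \<in> A" "p \<in> fst c"
  shows "tangent_space A p = range (coord_vec A c p)"
proof
  show "tangent_space A p \<subseteq> range (coord_vec A c p)"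
    using coord_vec_change_chart[OF assms(1) _ assms(2)] unfolding tangent_space_def by blast
  show "range (coord_vec A c p) \<subseteq> tangent_space A p"
    using assms unfolding tangent_space_def by blast
qed

lemma coord_vec_in_tangent_space: "c \<in> A \<Longrightarrow> p \<in> fst c \<Longrightarrow> coord_vec A c p a \<in> tangent_space A p"
  by (simp add: tangent_space_eq)

lemma subspace_tangent_space: "subspace (tangent_space A p)"
proof -
  obtain c where c: "c \<in> A" "p \<in> fst c" by (rule chart_at)
  show ?thesis
    using linear_subspace_image[OF linear_coord_vec[OF c] subspace_UNIV] tangent_space_eq[OF c] by simp
qed

lemmas tangent_space_closed =
  subspace_0[OF subspace_tangent_space] subspace_add[OF subspace_tangent_space]
  subspace_scale[OF subspace_tangent_space] subspace_diff[OF subspace_tangent_space]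
  subspace_sum[OF subspace_tangent_space]

lemma smooth_fun_on_chart_component:
  assumes "c \<in> A"
  shows "smooth_fun_on A (fst c) (\<lambda>q. snd c q \<bullet> b)"
proof (rule smooth_fun_on_chartI[OF assms open_chart[OF assms] order_refl])
  have "smooth_on (snd c ` fst c) (\<lambda>y. y \<bullet> b)"
    using open_chart_image[OF assms]
    by (rule smooth_on_bounded_linear[OF _ bounded_linear_inner_left smooth_on_id]) (rule open_chart_image[OF assms])
  then show "smooth_on (snd c ` fst c) ((\<lambda>q. snd c q \<bullet> b) \<circ> chart_inv c)"
    by (rule smooth_on_cong[OF open_chart_image[OF assms]]) (use assms in auto)
qed

lemma smooth_near_chart_component:
  "c \<in> A \<Longrightarrow> p \<in> fst c \<Longrightarrow> smooth_near A p (\<lambda>q. snd c q \<bullet> b)"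
  using smooth_nearI[OF smooth_fun_on_chart_component open_chart] by blast

text \<open>The coordinate functions are dual to the coordinate vectors, so they recover the
  components; this is what makes \<open>coord_vec\<close> injective.\<close>

lemma coord_vec_chart_component:
  assumes "c \<in> A" "p \<in> fst c"
  shows "coord_vec A c p a (\<lambda>q. snd c q \<bullet> b) = a \<bullet> b"
proof -
  have "((\<lambda>y. y \<bullet> b) has_derivative (\<lambda>a. a \<bullet> b)) (at (snd c p))"
    by (auto intro!: derivative_eq_intros)
  then have "((\<lambda>q. snd c q \<bullet> b) \<circ> chart_inv c has_derivative (\<lambda>a. a \<bullet> b)) (at (snd c p))"
    by (rule has_derivative_transform_within_open[OF _ open_chart_image[OF assms(1)]]) (use assms in auto)
  from coord_vec_eqI[OF smooth_near_chart_component[OF assms] assms this] show ?thesis .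
qed

lemma inj_coord_vec:
  assumes "c \<in> A" "p \<in> fst c"
  shows "inj (coord_vec A c p)"
proof (rule injI, rule euclidean_eqI)
  fix a b u assume "coord_vec A c p a = coord_vec A c p b"
  then show "a \<bullet> u = b \<bullet> u"
    using coord_vec_chart_component[OF assms] by metis
qed

lemma coord_vec_representation:
  assumes "c \<in> A" "p \<in> fst c"
  shows "coord_vec A c p a = (\<Sum>b\<in>Basis. (a \<bullet> b) *\<^sub>R coord_vec A c p b)"
proof -
  have "coord_vec A c p a = coord_vec A c p (\<Sum>b\<in>Basis. (a \<bullet> b) *\<^sub>R b)"
    by (simp add: euclidean_representation)
  then show ?thesis
    using linear_coord_vec[OF assms] by (simp add: linear_sum linear_scale)
qed

lemma coord_vec_cong:
  assumes "open W" "p \<in> W" "\<And>q. q \<in> W \<Longrightarrow> f q = h q" "c \<in> A" "p \<in> fst c"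
  shows "coord_vec A c p a f = coord_vec A c p a h"
proof (cases "smooth_near A p f")
  case True
  have h: "smooth_near A p h" using smooth_near_cong[OF True] assms by blast
  have "(h \<circ> chart_inv c has_derivative (\<lambda>a. coord_vec A c p a f)) (at (snd c p))"
    by (rule has_derivative_transform_within_open[OF smooth_near_has_derivative[OF True assms(4,5)]
          open_chart_image_Int[OF assms(4,1)]]) (use assms in auto)
  from coord_vec_eqI[OF h assms(4,5) this] show ?thesis by simp
next
  case False
  then have "\<not> smooth_near A p h" using smooth_near_cong[of p h W f] assms by auto
  then show ?thesis using False by (simp add: coord_vec_not_smooth)
qed

section \<open>Coordinate vector fields and their brackets\<close>

lemma coord_vec_apply_smooth:
  assumes c: "c \<in> A" and W: "open W" "W \<subseteq> fst c" and f: "smooth_fun_on A W f"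
  shows "smooth_fun_on A W (\<lambda>q. coord_vec A c q a f)"
    and "y \<in> snd c ` W \<Longrightarrow>
      coord_vec A c (chart_inv c y) a f = frechet_derivative (f \<circ> chart_inv c) (at y) a"
proof -
  have eq: "coord_vec A c (chart_inv c y) a f = frechet_derivative (f \<circ> chart_inv c) (at y) a"
    if y: "y \<in> snd c ` W" for y
  proof -
    obtain q where q: "q \<in> W" "y = snd c q" using y by blast
    then have "q \<in> fst c" using W by auto
    then show ?thesis
      using q smooth_nearI[OF f W(1) q(1)] c by (simp add: coord_vec_def)
  qed
  then show "y \<in> snd c ` W \<Longrightarrow>
      coord_vec A c (chart_inv c y) a f = frechet_derivative (f \<circ> chart_inv c) (at y) a" .
  have WU: "W \<inter> fst c = W" using W by auto
  have "smooth_on (snd c ` W) (\<lambda>y. frechet_derivative (f \<circ> chart_inv c) (at y) a)"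
    using smooth_on_frechet_derivative[OF smooth_fun_on_chartD[OF f c]] by (simp add: WU)
  then have "smooth_on (snd c ` W) ((\<lambda>q. coord_vec A c q a f) \<circ> chart_inv c)"
    by (rule smooth_on_cong[rotated]) (use eq open_chart_image_Int[OF c W(1)] WU in auto)
  then show "smooth_fun_on A W (\<lambda>q. coord_vec A c q a f)"
    by (rule smooth_fun_on_chartI[OF c W])
qed

lemma smooth_vf_on_coord_vec: "c \<in> A \<Longrightarrow> smooth_vf_on A (fst c) (\<lambda>q. coord_vec A c q a)"
  unfolding smooth_vf_on_def
  using coord_vec_in_tangent_space coord_vec_apply_smooth(1) by blast

lemma smooth_vf_near_coord_vec: "c \<in> A \<Longrightarrow> p \<in> fst c \<Longrightarrow> smooth_vf_near A p (\<lambda>q. coord_vec A c q a)"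
  unfolding smooth_vf_near_def using smooth_vf_on_coord_vec open_chart by blast

text \<open>In coordinates the two terms are the mixed second derivatives of \<open>f\<close>, which
  agree. This is the only bracket that the proof evaluates.\<close>

lemma lie_bracket_coord_vec:
  assumes c: "c \<in> A" "p \<in> fst c"
  shows "lie_bracket A (\<lambda>q. coord_vec A c q a) (\<lambda>q. coord_vec A c q b) p = 0"
proof
  fix f
  show "lie_bracket A (\<lambda>q. coord_vec A c q a) (\<lambda>q. coord_vec A c q b) p f = 0 f"
  proof (cases "smooth_near A p f")
    case True
    obtain W where W: "open W" "p \<in> W" "W \<subseteq> fst c" "open (snd c ` W)"
      "smooth_on (snd c ` W) (f \<circ> chart_inv c)" "smooth_fun_on A W f"
      by (rule smooth_nearE[OF True c])
    let ?F = "f \<circ> chart_inv c"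
    have "coord_vec A c p a (\<lambda>q. coord_vec A c q b f) =
        frechet_derivative (\<lambda>y. frechet_derivative ?F (at y) b) (at (snd c p)) a" for a b
    proof (rule coord_vec_eqI[OF _ c])
      show "smooth_near A p (\<lambda>q. coord_vec A c q b f)"
        using smooth_nearI coord_vec_apply_smooth(1)[OF c(1) W(1,3,6)] W by blast
      have "((\<lambda>y. frechet_derivative ?F (at y) b) has_derivative
          frechet_derivative (\<lambda>y. frechet_derivative ?F (at y) b) (at (snd c p))) (at (snd c p))"
        using smooth_on_differentiable[OF smooth_on_frechet_derivative[OF W(5)]] W(2)
          frechet_derivative_works by blast
      then show "((\<lambda>q. coord_vec A c q b f) \<circ> chart_inv c has_derivative
          frechet_derivative (\<lambda>y. frechet_derivative ?F (at y) b) (at (snd c p))) (at (snd c p))"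
        by (rule has_derivative_transform_within_open[OF _ W(4)])
          (use coord_vec_apply_smooth(2)[OF c(1) W(1,3,6)] W(2) in auto)
    qed
    then show ?thesis
      using frechet_derivative_commute[OF W(4,5)] W(2) True
      by (simp add: lie_bracket_def)
  qed (simp add: lie_bracket_def)
qed

section \<open>Velocities of curves\<close>

lemma has_real_derivative_along:
  assumes c: "c \<in> A" "\<gamma> s \<in> fst c" and cont: "isCont \<gamma> s"
    and a: "((snd c \<circ> \<gamma>) has_vector_derivative a) (at s)" and f: "smooth_near A (\<gamma> s) f"
  shows "((\<lambda>r. f (\<gamma> r)) has_real_derivative coord_vec A c (\<gamma> s) a f) (at s)"
proof -
  have D: "((f \<circ> chart_inv c) has_derivative (\<lambda>a. coord_vec A c (\<gamma> s) a f)) (at ((snd c \<circ> \<gamma>) s))"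
    using smooth_near_has_derivative[OF f c] by simp
  have D': "((f \<circ> chart_inv c \<circ> (snd c \<circ> \<gamma>)) has_derivative
      (\<lambda>a. coord_vec A c (\<gamma> s) a f) \<circ> (\<lambda>r. r *\<^sub>R a)) (at s)"
    using diff_chain_at[OF a[unfolded has_vector_derivative_def] D] .
  \<comment> \<open>The chain rule differentiates a composite through the chart, which equals
    \<open>f\<close> along the curve only while the curve stays in the chart domain.\<close>
  obtain J where J: "open J" "s \<in> J" "\<And>r. r \<in> J \<Longrightarrow> \<gamma> r \<in> fst c"
    using cont open_chart[OF c(1)] c(2) unfolding continuous_at_open by meson
  have "((\<lambda>r. f (\<gamma> r)) has_derivative
      (\<lambda>a. coord_vec A c (\<gamma> s) a f) \<circ> (\<lambda>r. r *\<^sub>R a)) (at s)"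
    by (rule has_derivative_transform_within_open[OF D' J(1,2)]) (use c J(3) in auto)
  moreover have "(\<lambda>a. coord_vec A c (\<gamma> s) a f) \<circ> (\<lambda>r. r *\<^sub>R a) = (*) (coord_vec A c (\<gamma> s) a f)"
    by (auto simp: linear_scale[OF linear_coord_vec[OF c]] scaleR_fun_def)
  ultimately show ?thesis
    by (simp add: has_field_derivative_def)
qed

lemma velocity_eq_coord_vec:
  assumes "c \<in> A" "\<gamma> s \<in> fst c" "isCont \<gamma> s" "((snd c \<circ> \<gamma>) has_vector_derivative a) (at s)"
  shows "velocity A \<gamma> s = coord_vec A c (\<gamma> s) a"
  using DERIV_imp_deriv[OF has_real_derivative_along[OF assms]]
  by (auto simp: velocity_def coord_vec_not_smooth)

end

locale manifold_curve = smooth_manifold A for A :: "('a::topological_space, 'e::euclidean_space) chart set" +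
  fixes I :: "real set" and \<gamma> :: "real \<Rightarrow> 'a"
  assumes open_I: "open I" and curve: "smooth_curve A I \<gamma>"
begin

abbreviation coord_velocity :: "('a, 'e) chart \<Rightarrow> real \<Rightarrow> 'e"
  where "coord_velocity c r \<equiv> vector_derivative (snd c \<circ> \<gamma>) (at r)"

lemma isCont_curve: "s \<in> I \<Longrightarrow> isCont \<gamma> s"
  using curve open_I by (simp add: smooth_curve_def continuous_on_eq_continuous_at)

lemma open_domain: "c \<in> A \<Longrightarrow> open (I \<inter> \<gamma> -` fst c)"
  using curve open_I open_chart 
    by (metis Int_commute continuous_on_open_vimage smooth_curve_def)

lemma smooth_on_chart_curve: "c \<in> A \<Longrightarrow> smooth_on (I \<inter> \<gamma> -` fst c) (snd c \<circ> \<gamma>)"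
  using curve unfolding smooth_curve_def case_prod_unfold by blast

lemma coord_velocity:
  assumes "c \<in> A" "s \<in> I" "\<gamma> s \<in> fst c"
  shows "((snd c \<circ> \<gamma>) has_vector_derivative coord_velocity c s) (at s)"
  using smooth_on_differentiable[OF smooth_on_chart_curve[OF assms(1)]] assms
  by (simp add: vector_derivative_works[symmetric])

lemma velocity_eq:
  "c \<in> A \<Longrightarrow> s \<in> I \<Longrightarrow> \<gamma> s \<in> fst c \<Longrightarrow> velocity A \<gamma> s = coord_vec A c (\<gamma> s) (coord_velocity c s)"
  by (simp add: velocity_eq_coord_vec isCont_curve coord_velocity)

lemma velocity_in_tangent_space: "s \<in> I \<Longrightarrow> velocity A \<gamma> s \<in> tangent_space A (\<gamma> s)"
  using chart_at[of "\<gamma> s"] velocity_eq coord_vec_in_tangent_space by metis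

lemma has_real_derivative_velocity:
  assumes "s \<in> I" "smooth_near A (\<gamma> s) f"
  shows "((\<lambda>r. f (\<gamma> r)) has_real_derivative velocity A \<gamma> s f) (at s)"
proof -
  obtain c where c: "c \<in> A" "\<gamma> s \<in> fst c" by (rule chart_at)
  show ?thesis
    using has_real_derivative_along[OF c isCont_curve coord_velocity] velocity_eq assms c by simp
qed

lemma coord_velocity_differentiable:
  assumes "c \<in> A" "s \<in> I" "\<gamma> s \<in> fst c"
  shows "coord_velocity c differentiable at s"
proof -
  have s: "s \<in> I \<inter> \<gamma> -` fst c" using assms by simp
  have d: "(\<lambda>r. frechet_derivative (snd c \<circ> \<gamma>) (at r) 1) differentiable at s"
    by (rule smooth_on_differentiable[OF smooth_on_frechet_derivative[OF smooth_on_chart_curve[OF assms(1)]] s])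
  \<comment> \<open>Smoothness is known for the Frechet derivative at 1. It agrees with the
    coordinate velocity on an open set of parameters around \<open>s\<close>, which is enough to
    transfer differentiability.\<close>
  have eq: "frechet_derivative (snd c \<circ> \<gamma>) (at r) 1 = coord_velocity c r" if "r \<in> I \<inter> \<gamma> -` fst c" for r
    using frechet_derivative_eq_vector_derivative[OF smooth_on_differentiable[OF smooth_on_chart_curve[OF assms(1)] that]]
    by simp
  obtain D where "((\<lambda>r. frechet_derivative (snd c \<circ> \<gamma>) (at r) 1) has_derivative D) (at s)"
    using d unfolding differentiable_def by blast
  then have "(coord_velocity c has_derivative D) (at s)"
    by (rule has_derivative_transform_within_open[OF _ open_domain[OF assms(1)] s eq])
  then show ?thesis
    unfolding differentiable_def by blast
qed

end

subsection \<open>Levi-Civita connections along curves\<close>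

text \<open>As a simp rule it eta-expands sums of tangent vectors, which are functions.\<close>

declare plus_fun_apply [simp del]

text \<open>Common ground of the Riemannian metric and the indefinite Lorentz metric, so that the
  calculus along curves is done once and instantiated twice. The algebraic laws are restricted to
  tangent vectors because the type \<open>tvec\<close> contains all operators.\<close>

locale pseudo_riemannian = smooth_manifold A
  for A :: "('a::topological_space, 'e::euclidean_space) chart set" +
  fixes g :: "'a metric_tensor" and nab :: "'a connection"
  assumes metric_linear_left: "u \<in> tangent_space A p \<Longrightarrow> v \<in> tangent_space A p \<Longrightarrow>
      w \<in> tangent_space A p \<Longrightarrow> g p (a *\<^sub>R u + b *\<^sub>R v) w = a * g p u w + b * g p v w"
    and metric_sym: "u \<in> tangent_space A p \<Longrightarrow> v \<in> tangent_space A p \<Longrightarrow> g p u v = g p v u"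
    and levi_civita: "levi_civita A g nab"
begin

lemma metric_add_left: "u \<in> tangent_space A p \<Longrightarrow> v \<in> tangent_space A p \<Longrightarrow>
    w \<in> tangent_space A p \<Longrightarrow> g p (u + v) w = g p u w + g p v w"
  using metric_linear_left[of u p v w 1 1] by simp

lemma metric_scale_left:
  "u \<in> tangent_space A p \<Longrightarrow> w \<in> tangent_space A p \<Longrightarrow> g p (a *\<^sub>R u) w = a * g p u w"
  using metric_linear_left[of u p 0 w a 0] tangent_space_closed(1) by simp

lemma metric_zero_left: "w \<in> tangent_space A p \<Longrightarrow> g p 0 w = 0"
  using metric_scale_left[of 0 p w 0] tangent_space_closed(1) by simp

lemma metric_add_right: "u \<in> tangent_space A p \<Longrightarrow> v \<in> tangent_space A p \<Longrightarrow>
    w \<in> tangent_space A p \<Longrightarrow> g p w (u + v) = g p w u + g p w v"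
  using metric_add_left metric_sym tangent_space_closed(2) by metis

lemma metric_scale_right:
  "u \<in> tangent_space A p \<Longrightarrow> w \<in> tangent_space A p \<Longrightarrow> g p w (a *\<^sub>R u) = a * g p w u"
  using metric_scale_left metric_sym tangent_space_closed(3) by metis

lemma metric_diff_right: "u \<in> tangent_space A p \<Longrightarrow> v \<in> tangent_space A p \<Longrightarrow>
    w \<in> tangent_space A p \<Longrightarrow> g p w (u - v) = g p w u - g p w v"
  using metric_add_right[of u p "(-1) *\<^sub>R v" w] metric_scale_right[of v p w "-1"]
    tangent_space_closed(3)[of v p "-1"] by simp

lemma metric_sum_left:
  "(\<And>i. i \<in> F \<Longrightarrow> u i \<in> tangent_space A p) \<Longrightarrow> w \<in> tangent_space A p \<Longrightarrow>
    g p (\<Sum>i\<in>F. u i) w = (\<Sum>i\<in>F. g p (u i) w)"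
proof (induction F rule: infinite_finite_induct)
  case (insert i F)
  then show ?case
    by (simp add: metric_add_left tangent_space_closed(5))
qed (simp_all add: metric_zero_left)

lemma affine: "affine_connection A nab"
  using levi_civita by (simp add: levi_civita_def)

lemma nab_in_tangent_space:
  "v \<in> tangent_space A p \<Longrightarrow> smooth_vf_near A p Y \<Longrightarrow> nab p v Y \<in> tangent_space A p"
  using affine[unfolded affine_connection_def, THEN conjunct1] by blast

lemma nab_linear:
  "u \<in> tangent_space A p \<Longrightarrow> v \<in> tangent_space A p \<Longrightarrow> smooth_vf_near A p Y \<Longrightarrow>
    nab p (a *\<^sub>R u + b *\<^sub>R v) Y = a *\<^sub>R nab p u Y + b *\<^sub>R nab p v Y"
  using affine[unfolded affine_connection_def, THEN conjunct2, THEN conjunct1] by blast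

lemma metric_compatible:
  "v \<in> tangent_space A p \<Longrightarrow> smooth_vf_near A p Y \<Longrightarrow> smooth_vf_near A p Z \<Longrightarrow>
    v (\<lambda>q. g q (Y q) (Z q)) = g p (nab p v Y) (Z p) + g p (Y p) (nab p v Z)"
  using levi_civita[unfolded levi_civita_def, THEN conjunct2, THEN conjunct2] by blast

text \<open>Torsion-freeness for commuting fields.\<close>

lemma nab_coord_vec_commute:
  assumes "c \<in> A" "p \<in> fst c"
  shows "nab p (coord_vec A c p a) (\<lambda>q. coord_vec A c q b) =
    nab p (coord_vec A c p b) (\<lambda>q. coord_vec A c q a)"
proof -
  have "nab p (coord_vec A c p a) (\<lambda>q. coord_vec A c q b) -
    nab p (coord_vec A c p b) (\<lambda>q. coord_vec A c q a) = 0"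
    using levi_civita[unfolded levi_civita_def, THEN conjunct2, THEN conjunct1, rule_format,
        OF smooth_vf_near_coord_vec[OF assms, of a] smooth_vf_near_coord_vec[OF assms, of b]]
    by (simp only: lie_bracket_coord_vec[OF assms])
  then show ?thesis by simp
qed

end

lemma smooth_vf_near_in_tangent_space: "smooth_vf_near A p Z \<Longrightarrow> Z p \<in> tangent_space A p"
  by (auto simp: smooth_vf_near_def smooth_vf_on_def)

locale pseudo_riemannian_curve = pseudo_riemannian A g nab + manifold_curve A I \<gamma>
  for A :: "('a::topological_space, 'e::euclidean_space) chart set"
    and g :: "'a metric_tensor" and nab :: "'a connection" and I :: "real set" and \<gamma> :: "real \<Rightarrow> 'a"
begin

lemma velocity_chart_component:
  "c \<in> A \<Longrightarrow> s \<in> I \<Longrightarrow> \<gamma> s \<in> fst c \<Longrightarrow> velocity A \<gamma> s (\<lambda>q. snd c q \<bullet> b) = coord_velocity c s \<bullet> b"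
  by (simp add: velocity_eq coord_vec_chart_component)

lemma deriv_velocity_chart_component:
  assumes "c \<in> A" "s \<in> I" "\<gamma> s \<in> fst c"
  shows "((\<lambda>r. coord_velocity c r \<bullet> b) has_real_derivative
    deriv (\<lambda>r. velocity A \<gamma> r (\<lambda>q. snd c q \<bullet> b)) s) (at s)"
proof -
  have s: "s \<in> I \<inter> \<gamma> -` fst c" using assms by simp
  have "(\<lambda>r. coord_velocity c r \<bullet> b) differentiable at s"
    using coord_velocity_differentiable[OF assms] by simp
  then obtain D where D: "((\<lambda>r. coord_velocity c r \<bullet> b) has_real_derivative D) (at s)"
    by (auto simp: real_differentiable_def)
  then have "((\<lambda>r. velocity A \<gamma> r (\<lambda>q. snd c q \<bullet> b)) has_real_derivative D) (at s)"
    by (rule has_field_derivative_transform_within_open[OF _ open_domain[OF assms(1)] s])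
      (use velocity_chart_component assms in auto)
  then show ?thesis using D DERIV_imp_deriv by metis
qed

lemma cov_deriv_in_chart_in_tangent_space:
  assumes "c \<in> A" "s \<in> I" "\<gamma> s \<in> fst c"
  shows "cov_deriv_in_chart A c nab \<gamma> (velocity A \<gamma>) s \<in> tangent_space A (\<gamma> s)"
  unfolding cov_deriv_in_chart_def
  using assms by (intro tangent_space_closed coord_vec_in_tangent_space nab_in_tangent_space
      velocity_in_tangent_space smooth_vf_near_coord_vec) auto

text \<open>The right-hand side mentions the chart \<open>c\<close> only in the covariant derivative of the velocity,
  and the left-hand side does not mention it at all: this is how charts are exchanged below.\<close>

lemma has_real_derivative_metric_velocity:
  assumes c: "c \<in> A" "\<gamma> s \<in> fst c" and s: "s \<in> I" and Z: "smooth_vf_near A (\<gamma> s) Z"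
    and smooth: "\<And>b. b \<in> Basis \<Longrightarrow> smooth_near A (\<gamma> s) (\<lambda>q. g q (coord_vec A c q b) (Z q))"
  shows "((\<lambda>r. g (\<gamma> r) (velocity A \<gamma> r) (Z (\<gamma> r))) has_real_derivative
    g (\<gamma> s) (cov_deriv_in_chart A c nab \<gamma> (velocity A \<gamma>) s) (Z (\<gamma> s))
    + g (\<gamma> s) (velocity A \<gamma> s) (nab (\<gamma> s) (velocity A \<gamma> s) Z)) (at s)"
proof -
  obtain U where U: "open U" "\<gamma> s \<in> U" "smooth_vf_on A U Z"
    using Z unfolding smooth_vf_near_def by blast
  let ?v = "velocity A \<gamma> s" and ?p = "\<gamma> s"
  let ?a' = "\<lambda>b. deriv (\<lambda>r. velocity A \<gamma> r (\<lambda>q. snd c q \<bullet> b)) s"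
  let ?G = "\<lambda>b q. g q (coord_vec A c q b) (Z q)"
  have v: "?v \<in> tangent_space A ?p" by (rule velocity_in_tangent_space[OF s])
  have Zp: "Z ?p \<in> tangent_space A ?p" by (rule smooth_vf_near_in_tangent_space[OF Z])
  note coords = smooth_vf_near_coord_vec[OF c] coord_vec_in_tangent_space[OF c]
  have nabZ: "nab ?p ?v Z \<in> tangent_space A ?p" by (rule nab_in_tangent_space[OF v Z])
  have nabc: "nab ?p ?v (\<lambda>q. coord_vec A c q b) \<in> tangent_space A ?p" for b
    by (rule nab_in_tangent_space[OF v coords(1)])
  have expand: "g q (coord_vec A c q a) w = (\<Sum>b\<in>Basis. (a \<bullet> b) * g q (coord_vec A c q b) w)"
    if "q \<in> fst c" "w \<in> tangent_space A q" for q a w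
  proof -
    have "g q (coord_vec A c q a) w = g q (\<Sum>b\<in>Basis. (a \<bullet> b) *\<^sub>R coord_vec A c q b) w"
      using coord_vec_representation[OF c(1) that(1)] by metis
    then show ?thesis
      using coord_vec_in_tangent_space[OF c(1) that(1)] that(2)
      by (simp add: metric_sum_left metric_scale_left tangent_space_closed(3))
  qed
  \<comment> \<open>Product rule for the expansion in components. Metric compatibility then splits
    \<open>?v (?G b)\<close>: one part completes the covariant derivative of the velocity, the other
    sums up to the term with \<open>nab ?p ?v Z\<close>.\<close>
  have "((\<lambda>r. \<Sum>b\<in>Basis. (coord_velocity c r \<bullet> b) * ?G b (\<gamma> r)) has_real_derivative
    (\<Sum>b\<in>Basis. ?a' b * ?G b ?p + ?v (?G b) * (coord_velocity c s \<bullet> b))) (at s)"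
    by (intro DERIV_sum DERIV_mult deriv_velocity_chart_component[OF c(1) s c(2)]
        has_real_derivative_velocity[OF s] smooth)
  moreover have "(\<Sum>b\<in>Basis. ?a' b * ?G b ?p + ?v (?G b) * (coord_velocity c s \<bullet> b)) =
    g ?p (cov_deriv_in_chart A c nab \<gamma> (velocity A \<gamma>) s) (Z ?p) + g ?p ?v (nab ?p ?v Z)"
  proof -
    have "g ?p (cov_deriv_in_chart A c nab \<gamma> (velocity A \<gamma>) s) (Z ?p) =
      (\<Sum>b\<in>Basis. ?a' b * ?G b ?p + (coord_velocity c s \<bullet> b) * g ?p (nab ?p ?v (\<lambda>q. coord_vec A c q b)) (Z ?p))"
      unfolding cov_deriv_in_chart_def velocity_chart_component[OF c(1) s c(2)]
      using coords(2) nabc Zp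
      by (simp add: metric_sum_left metric_linear_left tangent_space_closed(2,3))
    moreover have "g ?p ?v (nab ?p ?v Z) =
      (\<Sum>b\<in>Basis. (coord_velocity c s \<bullet> b) * g ?p (coord_vec A c ?p b) (nab ?p ?v Z))"
      using expand[OF c(2) nabZ, of "coord_velocity c s"]
      by (simp only: velocity_eq[OF c(1) s c(2), symmetric])
    moreover have "?v (?G b) = g ?p (nab ?p ?v (\<lambda>q. coord_vec A c q b)) (Z ?p)
        + g ?p (coord_vec A c ?p b) (nab ?p ?v Z)" for b
      by (rule metric_compatible[OF v coords(1) Z])
    ultimately show ?thesis
      by (simp add: sum.distrib[symmetric] algebra_simps)
  qed
  ultimately have D: "((\<lambda>r. \<Sum>b\<in>Basis. (coord_velocity c r \<bullet> b) * ?G b (\<gamma> r)) has_real_derivative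
    g ?p (cov_deriv_in_chart A c nab \<gamma> (velocity A \<gamma>) s) (Z ?p) + g ?p ?v (nab ?p ?v Z)) (at s)"
    by simp
  \<comment> \<open>The expansion needs \<open>Z\<close> to be tangent at \<open>\<gamma> r\<close>,
    which is known only inside \<open>U\<close>.\<close>
  obtain J where J: "open J" "s \<in> J" "\<And>r. r \<in> J \<Longrightarrow> \<gamma> r \<in> U"
    using isCont_curve[OF s] U unfolding continuous_at_open by meson
  show ?thesis
  proof (rule has_field_derivative_transform_within_open[OF D])
    show "open (J \<inter> (I \<inter> \<gamma> -` fst c))" using J open_domain[OF c(1)] by blast
    show "s \<in> J \<inter> (I \<inter> \<gamma> -` fst c)" using J s c by blast
    fix r assume r: "r \<in> J \<inter> (I \<inter> \<gamma> -` fst c)"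
    then have Zr: "Z (\<gamma> r) \<in> tangent_space A (\<gamma> r)" and r': "r \<in> I" "\<gamma> r \<in> fst c"
      using J U unfolding smooth_vf_on_def by blast+
    show "(\<Sum>b\<in>Basis. (coord_velocity c r \<bullet> b) * ?G b (\<gamma> r)) =
        g (\<gamma> r) (velocity A \<gamma> r) (Z (\<gamma> r))"
      unfolding velocity_eq[OF c(1) r'] by (rule expand[OF r'(2) Zr, symmetric])
  qed
qed

text \<open>Here the connection disappears. Torsion-freeness moves the differentiation from the
  coordinate field to \<open>?V\<close>, and the product of \<open>?V\<close> with its own covariant
  derivative is half the derivative of its square. As \<open>?V\<close> has the components of the
  velocity frozen at \<open>s\<close>, only metric coefficients are differentiated.\<close>

lemma metric_velocity_nab_coord_vec:
  assumes c: "c \<in> A" "\<gamma> s \<in> fst c" and s: "s \<in> I"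
  shows "g (\<gamma> s) (velocity A \<gamma> s) (nab (\<gamma> s) (velocity A \<gamma> s) (\<lambda>q. coord_vec A c q b)) =
    1/2 * coord_vec A c (\<gamma> s) b
      (\<lambda>q. g q (coord_vec A c q (coord_velocity c s)) (coord_vec A c q (coord_velocity c s)))"
proof -
  let ?V = "\<lambda>q. coord_vec A c q (coord_velocity c s)" and ?p = "\<gamma> s"
  note coords = smooth_vf_near_coord_vec[OF c] coord_vec_in_tangent_space[OF c]
  have "coord_vec A c ?p b (\<lambda>q. g q (?V q) (?V q)) =
      2 * g ?p (?V ?p) (nab ?p (coord_vec A c ?p b) ?V)"
    using metric_compatible[OF coords(2,1,1)]
      metric_sym[OF nab_in_tangent_space[OF coords(2,1)] coords(2)] by simp
  then show ?thesis
    using nab_coord_vec_commute[OF c, of "coord_velocity c s" b] velocity_eq[OF c(1) s c(2)] by simp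
qed

end

section \<open>Riemannian metrics: definiteness, sharp and gradient\<close>

locale riemannian = smooth_manifold A for A :: "('a::topological_space, 'e::euclidean_space) chart set" +
  fixes g :: "'a metric_tensor" and nab :: "'a connection"
  assumes metric: "riemannian_metric A g" and connection: "levi_civita A g nab"

sublocale riemannian \<subseteq> pseudo_riemannian A g nab
proof
  show "g p (a *\<^sub>R u + b *\<^sub>R v) w = a * g p u w + b * g p v w"
    if "u \<in> tangent_space A p" "v \<in> tangent_space A p" "w \<in> tangent_space A p" for u p v w a b
    using metric[unfolded riemannian_metric_def, THEN conjunct1] that by blast
  show "g p u v = g p v u" if "u \<in> tangent_space A p" "v \<in> tangent_space A p" for u p v
    using metric[unfolded riemannian_metric_def, THEN conjunct2, THEN conjunct1] that by blast
qed (rule connection)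

context riemannian
begin

lemma metric_pos: "v \<in> tangent_space A p \<Longrightarrow> v \<noteq> 0 \<Longrightarrow> g p v v > 0"
  using metric[unfolded riemannian_metric_def, THEN conjunct2, THEN conjunct2, THEN conjunct1] by blast

lemma smooth_near_metric:
  assumes "smooth_vf_near A p X" "smooth_vf_near A p Y"
  shows "smooth_near A p (\<lambda>q. g q (X q) (Y q))"
proof -
  obtain U where U: "open U" "p \<in> U" "smooth_vf_on A U X"
    using assms(1) unfolding smooth_vf_near_def by blast
  obtain V where V: "open V" "p \<in> V" "smooth_vf_on A V Y"
    using assms(2) unfolding smooth_vf_near_def by blast
  have "smooth_vf_on A (U \<inter> V) X" "smooth_vf_on A (U \<inter> V) Y"
    using U V unfolding smooth_vf_on_def by auto
  then have "smooth_fun_on A (U \<inter> V) (\<lambda>q. g q (X q) (Y q))"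
    using metric[unfolded riemannian_metric_def, THEN conjunct2, THEN conjunct2, THEN conjunct2] U V by blast
  then show ?thesis
    by (rule smooth_nearI) (use U V in auto)
qed

lemma metric_eqI:
  assumes "u \<in> tangent_space A p" "w \<in> tangent_space A p"
    and "\<And>v. v \<in> tangent_space A p \<Longrightarrow> g p v u = g p v w"
  shows "u = w"
proof (rule ccontr)
  assume "u \<noteq> w"
  have uw: "u - w \<in> tangent_space A p" using assms tangent_space_closed by blast
  have "g p (u - w) (u - w) = 0"
    using metric_diff_right[OF assms(1,2) uw] assms(3)[OF uw] by simp
  then show False
    using metric_pos[OF uw] \<open>u \<noteq> w\<close> by simp
qed

text \<open>Riesz representation in finite dimension: definiteness makes the Gram map injective,
  hence surjective.\<close>

lemma sharp_exists:
  assumes lin: "\<And>u v a b. u \<in> tangent_space A p \<Longrightarrow> v \<in> tangent_space A p \<Longrightarrow>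
      \<omega> (a *\<^sub>R u + b *\<^sub>R v) = a * \<omega> u + b * \<omega> v"
  shows "\<exists>w\<in>tangent_space A p. \<forall>v\<in>tangent_space A p. g p v w = \<omega> v"
proof -
  obtain c where c: "c \<in> A" "p \<in> fst c" by (rule chart_at)
  let ?L = "coord_vec A c p"
  have L: "linear ?L" by (rule linear_coord_vec[OF c])
  have T: "?L a \<in> tangent_space A p" for a by (rule coord_vec_in_tangent_space[OF c])
  have \<omega>: "linear (\<lambda>a. \<omega> (?L a))"
    using lin[OF T T, of 1 _ 1] lin[OF T T, where b=0]
    by (intro linearI) (simp_all add: linear_add[OF L] linear_scale[OF L])
  have gl: "linear (\<lambda>a. g p (?L a) w)" if "w \<in> tangent_space A p" for w
    using that T by (intro linearI)
      (simp_all add: linear_add[OF L] linear_scale[OF L] metric_add_left metric_scale_left)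
  \<comment> \<open>The Gram matrix of the coordinate basis as a linear map of the model space;
    solving \<open>F a = \<dots>\<close> for the components of \<open>\<omega>\<close> yields the
    representing vector.\<close>
  define F where "F a = (\<Sum>b\<in>Basis. g p (?L b) (?L a) *\<^sub>R b)" for a
  have F: "F a \<bullet> b = g p (?L b) (?L a)" for a b
  proof -
    have "F a \<bullet> b = (\<Sum>i\<in>Basis. (b \<bullet> i) * g p (?L i) (?L a))"
      by (simp add: F_def inner_sum_left inner_commute[of b] mult.commute)
    also have "\<dots> = g p (?L (\<Sum>i\<in>Basis. (b \<bullet> i) *\<^sub>R i)) (?L a)"
      by (simp add: linear_sum[OF gl[OF T[of a]]] linear_scale[OF gl[OF T[of a]]])
    finally show ?thesis by (simp add: euclidean_representation)
  qed
  have "linear F"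
    by (rule linearI; rule euclidean_eqI)
      (simp_all add: F inner_add_left linear_add[OF L] linear_scale[OF L] metric_add_right metric_scale_right T)
  moreover have "inj F"
  proof -
    have "a = 0" if "F a = 0" for a
    proof -
      have "g p (?L a) (?L a) = 0" using F[of a a] that by simp
      then have "?L a = 0" using metric_pos[OF T] by force
      then show ?thesis using inj_coord_vec[OF c] linear_0[OF L] by (metis injD)
    qed
    then show ?thesis using linear_injective_0[OF \<open>linear F\<close>] by blast
  qed
  ultimately have "surj F" by (rule linear_inj_imp_surj)
  then obtain a where a: "F a = (\<Sum>b\<in>Basis. \<omega> (?L b) *\<^sub>R b)" by (metis surjD)
  have "g p (?L d) (?L a) = \<omega> (?L d)" for d
  proof -
    have "g p (?L d) (?L a) = (\<Sum>i\<in>Basis. (d \<bullet> i) * \<omega> (?L i))"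
      using F[of a d] a by (simp add: inner_sum_left inner_commute[of d] mult.commute)
    also have "\<dots> = \<omega> (?L (\<Sum>i\<in>Basis. (d \<bullet> i) *\<^sub>R i))"
      by (simp add: linear_sum[OF \<omega>] linear_scale[OF \<omega>])
    finally show ?thesis by (simp add: euclidean_representation)
  qed
  then show ?thesis
    using T tangent_space_eq[OF c] by (intro bexI[of _ "?L a"]) auto
qed

text \<open>\<open>sharp\<close> is a definite description, so it needs existence, which rests on
  linearity of \<open>\<omega>\<close>, and uniqueness, which rests on definiteness of the
  metric.\<close>

lemma sharp:
  assumes "\<And>u v a b. u \<in> tangent_space A p \<Longrightarrow> v \<in> tangent_space A p \<Longrightarrow>
      \<omega> (a *\<^sub>R u + b *\<^sub>R v) = a * \<omega> u + b * \<omega> v"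
  shows sharp_in_tangent_space: "sharp A g p \<omega> \<in> tangent_space A p"
    and metric_sharp: "v \<in> tangent_space A p \<Longrightarrow> g p v (sharp A g p \<omega>) = \<omega> v"
proof -
  have "\<exists>!w. w \<in> tangent_space A p \<and> (\<forall>v\<in>tangent_space A p. g p v w = \<omega> v)"
    using sharp_exists[OF assms] metric_eqI by (metis (no_types, lifting))
  then have "sharp A g p \<omega> \<in> tangent_space A p \<and> (\<forall>v\<in>tangent_space A p. g p v (sharp A g p \<omega>) = \<omega> v)"
    unfolding sharp_def by (rule theI')
  then show "sharp A g p \<omega> \<in> tangent_space A p"
    and "v \<in> tangent_space A p \<Longrightarrow> g p v (sharp A g p \<omega>) = \<omega> v" by auto
qed

lemma
  shows grad_in_tangent_space: "grad A g f p \<in> tangent_space A p"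
    and metric_grad: "v \<in> tangent_space A p \<Longrightarrow> g p v (grad A g f p) = v f"
  unfolding grad_def using sharp[of p "\<lambda>v. v f"] by (simp_all add: scaleR_fun_def plus_fun_apply)

lemma
  assumes "v \<in> tangent_space A p" "smooth_vf_near A p \<delta>"
  shows sharp_rot_in_tangent_space: "sharp A g p (\<lambda>y. rot g nab \<delta> p y v) \<in> tangent_space A p"
    and metric_sharp_rot: "w \<in> tangent_space A p \<Longrightarrow>
      g p w (sharp A g p (\<lambda>y. rot g nab \<delta> p y v)) = rot g nab \<delta> p w v"
proof -
  have "rot g nab \<delta> p (a *\<^sub>R u + b *\<^sub>R u') v = a * rot g nab \<delta> p u v + b * rot g nab \<delta> p u' v"
    if "u \<in> tangent_space A p" "u' \<in> tangent_space A p" for u u' a b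
    using that assms nab_in_tangent_space[OF _ assms(2)]
    by (simp add: rot_def nab_form_def nab_linear metric_linear_left metric_add_right
        metric_scale_right tangent_space_closed(3) algebra_simps)
  note lin = this
  show "sharp A g p (\<lambda>y. rot g nab \<delta> p y v) \<in> tangent_space A p"
    and "w \<in> tangent_space A p \<Longrightarrow>
      g p w (sharp A g p (\<lambda>y. rot g nab \<delta> p y v)) = rot g nab \<delta> p w v"
    using sharp[of p "\<lambda>y. rot g nab \<delta> p y v", OF lin] by blast+
qed

end

locale riemannian_curve = riemannian A g nab + manifold_curve A I \<gamma>
  for A :: "('a::topological_space, 'e::euclidean_space) chart set"
    and g :: "'a metric_tensor" and nab :: "'a connection" and I :: "real set" and \<gamma> :: "real \<Rightarrow> 'a"

sublocale riemannian_curve \<subseteq> pseudo_riemannian_curve A g nab I \<gamma> ..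

context riemannian_curve
begin

text \<open>The derivative formula holds in every chart, in particular in the one picked by
  \<open>SOME\<close> inside \<open>cov_deriv_along\<close>. Afterwards that chart is never
  mentioned again.\<close>

lemma
  assumes s: "s \<in> I"
  shows cov_deriv_along_in_tangent_space:
      "cov_deriv_along A nab \<gamma> (velocity A \<gamma>) s \<in> tangent_space A (\<gamma> s)"
    and has_real_derivative_metric_velocity_along: "smooth_vf_near A (\<gamma> s) Z \<Longrightarrow>
      ((\<lambda>r. g (\<gamma> r) (velocity A \<gamma> r) (Z (\<gamma> r))) has_real_derivative
        g (\<gamma> s) (cov_deriv_along A nab \<gamma> (velocity A \<gamma>) s) (Z (\<gamma> s))
        + g (\<gamma> s) (velocity A \<gamma> s) (nab (\<gamma> s) (velocity A \<gamma> s) Z)) (at s)"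
proof -
  let ?c = "SOME c. c \<in> A \<and> \<gamma> s \<in> fst c"
  have "\<exists>c. c \<in> A \<and> \<gamma> s \<in> fst c" using chart_at by metis
  then have c: "?c \<in> A" "\<gamma> s \<in> fst ?c" using someI_ex by (metis (mono_tags, lifting))+
  show "cov_deriv_along A nab \<gamma> (velocity A \<gamma>) s \<in> tangent_space A (\<gamma> s)"
    unfolding cov_deriv_along_def by (rule cov_deriv_in_chart_in_tangent_space[OF c(1) s c(2)])
  assume Z: "smooth_vf_near A (\<gamma> s) Z"
  show "((\<lambda>r. g (\<gamma> r) (velocity A \<gamma> r) (Z (\<gamma> r))) has_real_derivative
        g (\<gamma> s) (cov_deriv_along A nab \<gamma> (velocity A \<gamma>) s) (Z (\<gamma> s))
        + g (\<gamma> s) (velocity A \<gamma> s) (nab (\<gamma> s) (velocity A \<gamma> s) Z)) (at s)"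
    unfolding cov_deriv_along_def
    by (rule has_real_derivative_metric_velocity[OF c s Z smooth_near_metric[OF smooth_vf_near_coord_vec[OF c] Z]])
qed

end

subsection \<open>The product with the real line\<close>

text \<open>As a function of the spatial chart it exhibits every chart of the product as coming from
  one of the factor, including a chart selected by \<open>SOME\<close>.\<close>

definition line_chart :: "('a, 'e) chart \<Rightarrow> (real \<times> 'a, real \<times> 'e) chart"
  where "line_chart c = (UNIV \<times> fst c, map_prod id (snd c))"

lemma line_chart_simps [simp]:
  "fst (line_chart c) = UNIV \<times> fst c" "snd (line_chart c) = map_prod id (snd c)"
  by (simp_all add: line_chart_def)

lemma line_prod_eq: "line_prod A = line_chart ` A"
  by (simp add: line_prod_def line_chart_def case_prod_unfold)

text \<open>Confined to the image, since \<open>inv_into\<close> is arbitrary elsewhere and need not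
  respect the product.\<close>

lemma inv_into_map_prod_id:
  assumes "inj_on \<phi> U" "snd z \<in> \<phi> ` U"
  shows "inv_into (UNIV \<times> U) (map_prod id \<phi>) z = (fst z, inv_into U \<phi> (snd z))"
proof (rule inv_into_f_eq)
  show "inj_on (map_prod id \<phi>) (UNIV \<times> U)"
    using assms(1) by (auto simp: inj_on_def)
  show "(fst z, inv_into U \<phi> (snd z)) \<in> UNIV \<times> U"
    using assms(2) by (simp add: inv_into_into)
  show "map_prod id \<phi> (fst z, inv_into U \<phi> (snd z)) = z"
    using assms(2) by (simp add: f_inv_into_f)
qed

lemma smooth_on_compose_snd:
  fixes f :: "'e::euclidean_space \<Rightarrow> 'b::real_normed_vector"
  assumes "open S" "smooth_on S f"
  shows "smooth_on ((UNIV :: real set) \<times> S) (\<lambda>z. f (snd z))"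
proof -
  have op: "open ((UNIV :: real set) \<times> S)" using assms(1) by (simp add: open_Times)
  show ?thesis
    by (rule smooth_on_compose[OF op assms(1) _ assms(2)
          smooth_on_bounded_linear[OF op bounded_linear_snd smooth_on_id[OF op]]]) auto
qed

lemma map_prod_id_image: "map_prod id \<phi> ` (UNIV \<times> U) = UNIV \<times> \<phi> ` U"
  by force

context smooth_manifold
begin

lemma inv_into_line_chart:
  "c \<in> A \<Longrightarrow> z \<in> UNIV \<times> snd c ` fst c \<Longrightarrow>
    inv_into (UNIV \<times> fst c) (map_prod id (snd c)) z = (fst z, chart_inv c (snd z))"
  by (rule inv_into_map_prod_id[OF inj_on_chart]) (simp_all add: mem_Times_iff)

lemma smooth_atlas_line_prod: "smooth_atlas (line_prod A)"
proof -
  have op: "open ((UNIV :: real set) \<times> fst c)" if "c \<in> A" for c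
    using open_chart[OF that] by (simp add: open_Times)
  have op': "open (map_prod id (snd c) ` ((UNIV :: real set) \<times> fst c))" if "c \<in> A" for c
    using open_chart_image[OF that] by (simp add: open_Times map_prod_id_image)
  have homeo: "homeomorphism ((UNIV :: real set) \<times> fst c) (map_prod id (snd c) ` (UNIV \<times> fst c))
      (map_prod id (snd c)) (inv_into (UNIV \<times> fst c) (map_prod id (snd c)))" if c: "c \<in> A" for c
  proof -
    have h: "continuous_on (fst c) (snd c)" "continuous_on (snd c ` fst c) (chart_inv c)"
      using homeomorphism_chart[OF c] by (auto simp: homeomorphism_def)
    have "continuous_on ((UNIV :: real set) \<times> fst c) (\<lambda>z. (fst z, snd c (snd z)))"
      by (intro continuous_intros continuous_on_compose2[OF h(1)]) auto
    then have cont: "continuous_on ((UNIV :: real set) \<times> fst c) (map_prod id (snd c))"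
      by (rule continuous_on_eq) auto
    have "continuous_on ((UNIV :: real set) \<times> snd c ` fst c) (\<lambda>z. (fst z, chart_inv c (snd z)))"
      by (intro continuous_intros continuous_on_compose2[OF h(2)]) auto
    then have cont': "continuous_on (UNIV \<times> snd c ` fst c)
        (inv_into ((UNIV :: real set) \<times> fst c) (map_prod id (snd c)))"
      by (rule continuous_on_eq) (simp add: inv_into_line_chart[OF c])
    have inj: "inj_on (map_prod id (snd c)) ((UNIV :: real set) \<times> fst c)"
      using inj_on_chart[OF c] by (auto simp: inj_on_def)
    show ?thesis
    proof (rule homeomorphismI[OF cont cont'[folded map_prod_id_image] order_refl])
      show "inv_into (UNIV \<times> fst c) (map_prod id (snd c)) ` map_prod id (snd c) ` (UNIV \<times> fst c)
          \<subseteq> (UNIV :: real set) \<times> fst c"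
        using inv_into_f_f[OF inj] by auto
    qed (use inv_into_f_f[OF inj] in auto)
  qed
  have trans: "smooth_on (map_prod id (snd c) ` ((UNIV \<times> fst c) \<inter> (UNIV \<times> fst d)))
      (map_prod id (snd d) \<circ> inv_into ((UNIV :: real set) \<times> fst c) (map_prod id (snd c)))"
    if c: "c \<in> A" and d: "d \<in> A" for c d
  proof -
    let ?S = "snd c ` (fst c \<inter> fst d)"
    have S: "open ?S"
      using open_chart_image_Int[OF c open_chart[OF d]] by (simp add: Int_commute)
    have op: "open ((UNIV :: real set) \<times> ?S)" using S by (simp add: open_Times)
    have "smooth_on ((UNIV :: real set) \<times> ?S) (\<lambda>z. (fst z, (snd d \<circ> chart_inv c) (snd z)))"
      by (rule smooth_on_Pair[OF op smooth_on_bounded_linear[OF op bounded_linear_fst smooth_on_id[OF op]]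
            smooth_on_compose_snd[OF S smooth_on_transition[OF c d]]])
    then have "smooth_on ((UNIV :: real set) \<times> ?S)
        (map_prod id (snd d) \<circ> inv_into ((UNIV :: real set) \<times> fst c) (map_prod id (snd c)))"
      by (rule smooth_on_cong[OF op]) (auto simp: inv_into_line_chart[OF c])
    moreover have "(UNIV \<times> fst c) \<inter> (UNIV \<times> fst d) = (UNIV :: real set) \<times> (fst c \<inter> fst d)" by auto
    ultimately show ?thesis by (simp only: map_prod_id_image)
  qed
  have cover: "\<exists>c\<in>A. p \<in> fst c" for p
    by (rule chart_at[of p]) blast
  show ?thesis
    unfolding smooth_atlas_def case_prod_unfold line_prod_eq ball_simps line_chart_simps
    using cover op op' homeo trans by auto
qed

lemma smooth_manifold_line_prod: "smooth_manifold (line_prod A)"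
  by standard (rule smooth_atlas_line_prod)

lemma line_chart_in_line_prod: "c \<in> A \<Longrightarrow> line_chart c \<in> line_prod A"
  by (simp add: line_prod_eq)

lemma smooth_near_snd:
  assumes "smooth_near A (snd p) f"
  shows "smooth_near (line_prod A) p (\<lambda>q. f (snd q))"
proof -
  interpret L: smooth_manifold "line_prod A" by (rule smooth_manifold_line_prod)
  obtain c where c: "c \<in> A" "snd p \<in> fst c" by (rule chart_at)
  obtain W where W: "open W" "snd p \<in> W" "W \<subseteq> fst c" "open (snd c ` W)"
      "smooth_on (snd c ` W) (f \<circ> chart_inv c)"
    by (rule smooth_nearE[OF assms c])
  have op: "open ((UNIV :: real set) \<times> snd c ` W)" using W by (simp add: open_Times)
  show ?thesis
  proof (rule L.smooth_nearI_chart[OF line_chart_in_line_prod[OF c(1)], of _ "UNIV \<times> W"])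
    have "smooth_on ((UNIV :: real set) \<times> snd c ` W)
        ((\<lambda>q. f (snd q)) \<circ> inv_into (UNIV \<times> fst c) (map_prod id (snd c)))"
      by (rule smooth_on_cong[OF op smooth_on_compose_snd[OF W(4,5)]])
        (use W(3) in \<open>auto simp: inv_into_line_chart[OF c(1)] subset_iff\<close>)
    then show "smooth_on (snd (line_chart c) ` (UNIV \<times> W))
        ((\<lambda>q. f (snd q)) \<circ> inv_into (fst (line_chart c)) (snd (line_chart c)))"
      by (simp only: line_chart_simps map_prod_id_image)
  qed (use W in \<open>auto simp: open_Times mem_Times_iff\<close>)
qed

section \<open>Coordinate vectors of the product and their projections\<close>

lemma coord_vec_line_fst:
  assumes c: "c \<in> A" "snd p \<in> fst c"
  shows "coord_vec (line_prod A) (line_chart c) p a fst = fst a"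
proof -
  interpret L: smooth_manifold "line_prod A" by (rule smooth_manifold_line_prod)
  have C: "line_chart c \<in> line_prod A" "p \<in> fst (line_chart c)"
    using c by (auto simp: line_chart_in_line_prod mem_Times_iff)
  \<comment> \<open>A product chart is the identity on the line, so dt is its component function
    along the first basis direction.\<close>
  have "(\<lambda>q. snd (line_chart c) q \<bullet> (1, 0)) = fst"
    by (auto simp: fun_eq_iff inner_Pair)
  then show ?thesis
    using L.coord_vec_chart_component[OF C, of a "(1, 0)"] by (simp add: inner_prod_def)
qed

text \<open>A function pulled back from the factor is blind to the time component of
  \<open>a\<close>. This is how the independence of the Lorentz coefficients from t enters.\<close>

lemma coord_vec_line_snd:
  assumes c: "c \<in> A" "snd p \<in> fst c" and f: "smooth_near A (snd p) f"
  shows "coord_vec (line_prod A) (line_chart c) p a (\<lambda>q. f (snd q)) = coord_vec A c (snd p) (snd a) f"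
proof -
  interpret L: smooth_manifold "line_prod A" by (rule smooth_manifold_line_prod)
  have C: "line_chart c \<in> line_prod A" "p \<in> fst (line_chart c)"
    using c by (auto simp: line_chart_in_line_prod mem_Times_iff)
  have op: "open ((UNIV :: real set) \<times> snd c ` fst c)"
    using open_chart_image[OF c(1)] by (simp add: open_Times)
  have D: "((f \<circ> chart_inv c) has_derivative (\<lambda>b. coord_vec A c (snd p) b f))
      (at (snd (map_prod id (snd c) p)))"
    using smooth_near_has_derivative[OF f c] by (cases p) simp
  have "(snd has_derivative snd) (at (map_prod id (snd c) p))"
    by (rule bounded_linear_imp_has_derivative[OF bounded_linear_snd])
  from diff_chain_at[OF this D]
  have "((f \<circ> chart_inv c) \<circ> snd has_derivative (\<lambda>b. coord_vec A c (snd p) b f) \<circ> snd)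
      (at (map_prod id (snd c) p))" .
  then have "((\<lambda>q. f (snd q)) \<circ> inv_into (fst (line_chart c)) (snd (line_chart c)) has_derivative
      (\<lambda>b. coord_vec A c (snd p) b f) \<circ> snd) (at (snd (line_chart c) p))"
    unfolding line_chart_simps
    by (rule has_derivative_transform_within_open[OF _ op])
      (use c in \<open>auto simp: inv_into_line_chart[OF c(1)] mem_Times_iff\<close>)
  from L.coord_vec_eqI[OF smooth_near_snd[OF f] C this] show ?thesis by simp
qed

lemma differential_snd_coord_vec:
  assumes "c \<in> A" "snd p \<in> fst c"
  shows "differential A snd p (coord_vec (line_prod A) (line_chart c) p a) = coord_vec A c (snd p) (snd a)"
  using coord_vec_line_snd[OF assms]
  by (auto simp: differential_def o_def fun_eq_iff coord_vec_not_smooth)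

lemma differential_in_tangent_space:
  assumes "u \<in> tangent_space (line_prod A) p"
  shows "differential A snd p u \<in> tangent_space A (snd p)"
proof -
  interpret L: smooth_manifold "line_prod A" by (rule smooth_manifold_line_prod)
  obtain c where c: "c \<in> A" "snd p \<in> fst c" by (rule chart_at)
  have C: "line_chart c \<in> line_prod A" "p \<in> fst (line_chart c)"
    using c by (auto simp: line_chart_in_line_prod mem_Times_iff)
  show ?thesis
    using assms differential_snd_coord_vec[OF c] coord_vec_in_tangent_space[OF c]
    unfolding L.tangent_space_eq[OF C] by auto
qed

text \<open>Turns \<open>partial_t\<close>, defined without charts as the velocity of a time line,
  into a coordinate field, to which torsion-freeness and the derivative formulas apply.\<close>

lemma partial_t_eq:
  assumes c: "c \<in> A" "snd p \<in> fst c"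
  shows "partial_t A p = coord_vec (line_prod A) (line_chart c) p (1, 0)"
proof -
  interpret L: smooth_manifold "line_prod A" by (rule smooth_manifold_line_prod)
  have "((\<lambda>r. (r, snd c (snd p))) has_vector_derivative (1, 0)) (at (fst p))"
    by (intro has_vector_derivative_Pair has_vector_derivative_const has_vector_derivative_id)
  moreover have "(\<lambda>r. (r, snd c (snd p))) = snd (line_chart c) \<circ> (\<lambda>r. (r, snd p))"
    by (auto simp: fun_eq_iff)
  ultimately have "(snd (line_chart c) \<circ> (\<lambda>r. (r, snd p)) has_vector_derivative (1, 0)) (at (fst p))"
    by simp
  moreover have "isCont (\<lambda>r. (r, snd p)) (fst p)"
    by (intro continuous_intros)
  ultimately show ?thesis
    unfolding partial_t_def
    using L.velocity_eq_coord_vec[OF line_chart_in_line_prod[OF c(1)], of "\<lambda>r. (r, snd p)" "fst p"] c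
    by (simp add: mem_Times_iff)
qed

lemma smooth_curve_snd:
  assumes "open I" "smooth_curve (line_prod A) I (\<lambda>s. (t s, x s))"
  shows "smooth_curve A I x"
proof -
  have "continuous_on I (\<lambda>s. (t s, x s))" using assms(2) by (simp add: smooth_curve_def)
  from continuous_on_snd[OF this] have x: "continuous_on I x" by simp
  have "smooth_on (I \<inter> x -` fst c) (snd c \<circ> x)" if c: "c \<in> A" for c
  proof -
    have op: "open (I \<inter> x -` fst c)"
      using x assms(1) open_chart[OF c] by (metis continuous_on_open_vimage Int_commute)
    have "smooth_on (I \<inter> (\<lambda>s. (t s, x s)) -` fst (line_chart c)) (snd (line_chart c) \<circ> (\<lambda>s. (t s, x s)))"
      using assms(2) line_chart_in_line_prod[OF c] unfolding smooth_curve_def case_prod_unfold by blast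
    moreover have "I \<inter> (\<lambda>s. (t s, x s)) -` fst (line_chart c) = I \<inter> x -` fst c" by auto
    ultimately have "smooth_on (I \<inter> x -` fst c) (snd (line_chart c) \<circ> (\<lambda>s. (t s, x s)))" by simp
    from smooth_on_bounded_linear[OF op bounded_linear_snd this] show ?thesis by (simp add: o_def)
  qed
  then show ?thesis
    unfolding smooth_curve_def case_prod_unfold using x by blast
qed

lemma coord_vec_add_fun:
  assumes c: "c \<in> A" "p \<in> fst c" and f: "smooth_near A p f" and h: "smooth_near A p h"
  shows "coord_vec A c p a (\<lambda>q. f q + h q) = coord_vec A c p a f + coord_vec A c p a h"
proof -
  have "((\<lambda>q. f q + h q) \<circ> chart_inv c has_derivative
      (\<lambda>a. coord_vec A c p a f + coord_vec A c p a h)) (at (snd c p))"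
    using has_derivative_add[OF smooth_near_has_derivative[OF f c] smooth_near_has_derivative[OF h c]]
    by (simp add: o_def)
  from coord_vec_eqI[OF smooth_near_add[OF f h] c this] show ?thesis .
qed

lemma coord_vec_cmult_fun:
  assumes c: "c \<in> A" "p \<in> fst c" and f: "smooth_near A p f"
  shows "coord_vec A c p a (\<lambda>q. r * f q) = r * coord_vec A c p a f"
proof -
  have "((\<lambda>q. r * f q) \<circ> chart_inv c has_derivative (\<lambda>a. r * coord_vec A c p a f)) (at (snd c p))"
    using has_derivative_mult_right[OF smooth_near_has_derivative[OF f c]] by (simp add: o_def)
  from coord_vec_eqI[OF smooth_near_cmult[OF f] c this] show ?thesis .
qed

end

lemma differential_linear:
  "differential A F p (a *\<^sub>R u + b *\<^sub>R v) = a *\<^sub>R differential A F p u + b *\<^sub>R differential A F p v"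
  by (auto simp: differential_def fun_eq_iff plus_fun_apply scaleR_fun_def)

subsection \<open>The Lorentz metric and its geodesics\<close>

locale stationary_spacetime = riemannian A g nabR
  for A :: "('a::topological_space, 'e::euclidean_space) chart set"
    and g :: "'a metric_tensor" and nabR :: "'a connection" +
  fixes \<beta> :: "'a \<Rightarrow> real" and \<delta> :: "'a \<Rightarrow> 'a tvec" and nab :: "(real \<times> 'a) connection"
  assumes stationary: "standard_stationary A g \<beta> \<delta>"
    and lorentz_connection: "levi_civita (line_prod A) (stationary_metric A g \<beta> \<delta>) nab"
begin

abbreviation "gL \<equiv> stationary_metric A g \<beta> \<delta>"

lemma \<beta>_pos: "\<beta> p > 0"
  using stationary by (simp add: standard_stationary_def)

lemma smooth_near_\<beta>: "smooth_near A p \<beta>"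
  using stationary by (intro smooth_nearI[of UNIV]) (simp_all add: standard_stationary_def)

lemma smooth_vf_near_\<delta>: "smooth_vf_near A p \<delta>"
  using stationary unfolding standard_stationary_def smooth_vf_near_def by blast

lemma \<delta>_in_tangent_space: "\<delta> p \<in> tangent_space A p"
  by (rule smooth_vf_near_in_tangent_space[OF smooth_vf_near_\<delta>])

lemma lorentz_def: "gL p u w = - \<beta> (snd p) * u fst * w fst
    + g (snd p) (differential A snd p u) (differential A snd p w)
    + u fst * g (snd p) (\<delta> (snd p)) (differential A snd p w)
    + w fst * g (snd p) (\<delta> (snd p)) (differential A snd p u)"
  by (simp add: stationary_metric_def Let_def)

end

sublocale stationary_spacetime \<subseteq> L: pseudo_riemannian "line_prod A" "stationary_metric A g \<beta> \<delta>" nab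
proof
  show "smooth_atlas (line_prod A)" by (rule smooth_atlas_line_prod)
  show "gL p (a *\<^sub>R u + b *\<^sub>R v) w = a * gL p u w + b * gL p v w"
    if "u \<in> tangent_space (line_prod A) p" "v \<in> tangent_space (line_prod A) p"
      "w \<in> tangent_space (line_prod A) p" for u p v w a b
  proof -
    have "(a *\<^sub>R u + b *\<^sub>R v) fst = a * u fst + b * v fst"
      by (simp add: plus_fun_apply scaleR_fun_def)
    then show ?thesis
      using that[THEN differential_in_tangent_space]
      by (simp add: lorentz_def differential_linear metric_linear_left metric_add_right metric_scale_right
          \<delta>_in_tangent_space tangent_space_closed algebra_simps)
  qed
  show "gL p u v = gL p v u"
    if "u \<in> tangent_space (line_prod A) p" "v \<in> tangent_space (line_prod A) p" for u p v
    using metric_sym[OF that[THEN differential_in_tangent_space]] by (simp add: lorentz_def)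
qed (rule lorentz_connection)

context stationary_spacetime
begin

section \<open>The Lorentz metric in product charts\<close>

lemma lorentz_coord_vec:
  assumes "c \<in> A" "snd p \<in> fst c"
  shows "gL p (coord_vec (line_prod A) (line_chart c) p a) (coord_vec (line_prod A) (line_chart c) p b) =
    - \<beta> (snd p) * fst a * fst b
    + g (snd p) (coord_vec A c (snd p) (snd a)) (coord_vec A c (snd p) (snd b))
    + fst a * g (snd p) (\<delta> (snd p)) (coord_vec A c (snd p) (snd b))
    + fst b * g (snd p) (\<delta> (snd p)) (coord_vec A c (snd p) (snd a))"
  by (simp add: lorentz_def coord_vec_line_fst[OF assms] differential_snd_coord_vec[OF assms])

text \<open>Near \<open>p\<close> the coefficient is \<open>?F\<close> composed with the projection,
  for a smooth \<open>?F\<close> on the factor. So only \<open>snd d\<close> matters, and every term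
  vanishes for the time direction.\<close>

lemma
  assumes c: "c \<in> A" "snd p \<in> fst c"
  shows smooth_near_lorentz_coord_vec: "smooth_near (line_prod A) p
      (\<lambda>q. gL q (coord_vec (line_prod A) (line_chart c) q a) (coord_vec (line_prod A) (line_chart c) q b))"
    and coord_vec_lorentz: "coord_vec (line_prod A) (line_chart c) p d
      (\<lambda>q. gL q (coord_vec (line_prod A) (line_chart c) q a) (coord_vec (line_prod A) (line_chart c) q b)) =
      - (fst a * fst b) * coord_vec A c (snd p) (snd d) \<beta>
      + coord_vec A c (snd p) (snd d) (\<lambda>q. g q (coord_vec A c q (snd a)) (coord_vec A c q (snd b)))
      + fst a * coord_vec A c (snd p) (snd d) (\<lambda>q. g q (\<delta> q) (coord_vec A c q (snd b)))
      + fst b * coord_vec A c (snd p) (snd d) (\<lambda>q. g q (\<delta> q) (coord_vec A c q (snd a)))"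
proof -
  let ?X = "\<lambda>a q. coord_vec A c q a"
  let ?G = "\<lambda>q. gL q (coord_vec (line_prod A) (line_chart c) q a) (coord_vec (line_prod A) (line_chart c) q b)"
  let ?F = "\<lambda>y. - (fst a * fst b) * \<beta> y + g y (?X (snd a) y) (?X (snd b) y)
    + fst a * g y (\<delta> y) (?X (snd b) y) + fst b * g y (\<delta> y) (?X (snd a) y)"
  note X = smooth_vf_near_coord_vec[OF c]
  note smooth = smooth_near_cmult smooth_near_add smooth_near_\<beta> smooth_near_metric[OF X X]
    smooth_near_metric[OF smooth_vf_near_\<delta> X]
  have F: "smooth_near A (snd p) ?F"
    by (intro smooth)
  have W: "open ((UNIV :: real set) \<times> fst c)" "p \<in> UNIV \<times> fst c"
    using c open_chart by (auto simp: open_Times mem_Times_iff)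
  have eq: "?F (snd q) = ?G q" if "q \<in> UNIV \<times> fst c" for q
    using lorentz_coord_vec[OF c(1), of q a b] that by (simp add: mem_Times_iff)
  show "smooth_near (line_prod A) p ?G"
    by (rule L.smooth_near_cong[OF smooth_near_snd[OF F] W eq])
  have C: "line_chart c \<in> line_prod A" "p \<in> fst (line_chart c)"
    using c by (auto simp: line_chart_in_line_prod mem_Times_iff)
  have "coord_vec (line_prod A) (line_chart c) p d ?G =
      coord_vec (line_prod A) (line_chart c) p d (\<lambda>q. ?F (snd q))"
    by (rule L.coord_vec_cong[OF W eq[symmetric] C])
  also have "\<dots> = coord_vec A c (snd p) (snd d) ?F"
    by (rule coord_vec_line_snd[OF c F])
  also have "\<dots> = - (fst a * fst b) * coord_vec A c (snd p) (snd d) \<beta>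
      + coord_vec A c (snd p) (snd d) (\<lambda>q. g q (?X (snd a) q) (?X (snd b) q))
      + fst a * coord_vec A c (snd p) (snd d) (\<lambda>q. g q (\<delta> q) (?X (snd b) q))
      + fst b * coord_vec A c (snd p) (snd d) (\<lambda>q. g q (\<delta> q) (?X (snd a) q))"
  proof -
    have 1: "smooth_near A (snd p) (\<lambda>y. - (fst a * fst b) * \<beta> y)"
      "smooth_near A (snd p) (\<lambda>y. g y (?X (snd a) y) (?X (snd b) y))"
      "smooth_near A (snd p) (\<lambda>y. fst a * g y (\<delta> y) (?X (snd b) y))"
      "smooth_near A (snd p) (\<lambda>y. fst b * g y (\<delta> y) (?X (snd a) y))"
      by (intro smooth)+
    note 2 = smooth_near_add[OF 1(1,2)] 
    note 3 = smooth_near_add[OF 2 1(3)]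
    show ?thesis
      unfolding coord_vec_add_fun[OF c 3 1(4)] coord_vec_add_fun[OF c 2 1(3)] coord_vec_add_fun[OF c 1(1,2)]
        coord_vec_cmult_fun[OF c smooth_near_\<beta>]
        coord_vec_cmult_fun[OF c smooth_near_metric[OF smooth_vf_near_\<delta> X]] ..
  qed
  finally show "coord_vec (line_prod A) (line_chart c) p d ?G = \<dots>" .
qed

text \<open>Orthogonality to spatial vectors forces the spatial part of \<open>u\<close> to be
  \<open>- \<tau>\<close> times \<open>\<delta>\<close>. The remaining condition then reads
  \<open>(\<beta> + \<langle>\<delta>, \<delta>\<rangle>) \<tau> = 0\<close>, with the positive
  factor that is inverted in \<open>Lam\<close>.\<close>

lemma lorentz_nondegenerate:
  assumes c: "c \<in> A" "snd p \<in> fst c" and u: "u \<in> tangent_space (line_prod A) p"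
    and t: "gL p u (coord_vec (line_prod A) (line_chart c) p (1, 0)) = 0"
    and x: "\<And>b. gL p u (coord_vec (line_prod A) (line_chart c) p (0, b)) = 0"
  shows "u = 0"
proof -
  have C: "line_chart c \<in> line_prod A" "p \<in> fst (line_chart c)"
    using c by (auto simp: line_chart_in_line_prod mem_Times_iff)
  obtain \<tau> a where u: "u = coord_vec (line_prod A) (line_chart c) p (\<tau>, a)"
    using u unfolding L.tangent_space_eq[OF C] by auto
  let ?X = "coord_vec A c (snd p)" and ?g = "g (snd p)" and ?\<delta> = "\<delta> (snd p)"
  note T = coord_vec_in_tangent_space[OF c] and \<delta> = \<delta>_in_tangent_space[of "snd p"]
  have zero: "?X 0 = 0" using linear_coord_vec[OF c] by (rule linear_0)
  have "?X a = (- \<tau>) *\<^sub>R ?\<delta>"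
  proof (rule metric_eqI[OF T tangent_space_closed(3)[OF \<delta>]])
    fix v assume v: "v \<in> tangent_space A (snd p)"
    then obtain b where b: "v = ?X b" unfolding tangent_space_eq[OF c] by auto
    show "?g v (?X a) = ?g v ((- \<tau>) *\<^sub>R ?\<delta>)"
      using x[of b] metric_sym[OF T T, of a b] metric_sym[OF \<delta> T, of b] metric_scale_right[OF \<delta> v, of "- \<tau>"]
      by (simp add: u b lorentz_coord_vec[OF c])
  qed
  moreover have "\<beta> (snd p) * \<tau> = ?g ?\<delta> (?X a)"
    using t metric_zero_left[OF T] metric_sym[OF T T, of a 0] metric_sym[OF \<delta> T, of 0] metric_zero_left[OF \<delta>]
    by (simp add: u lorentz_coord_vec[OF c] zero)
  ultimately have "\<beta> (snd p) * \<tau> = - \<tau> * ?g ?\<delta> ?\<delta>"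
    using metric_scale_right[OF \<delta> \<delta>, of "- \<tau>"] by simp
  then have "(\<beta> (snd p) + ?g ?\<delta> ?\<delta>) * \<tau> = 0"
    by (simp add: algebra_simps)
  moreover have "?g ?\<delta> ?\<delta> \<ge> 0"
    using metric_pos[OF \<delta>] metric_zero_left[OF \<delta>] by (cases "?\<delta> = 0") auto
  ultimately have "\<tau> = 0" using \<beta>_pos[of "snd p"] by (smt (verit) mult_eq_0_iff)
  with \<open>?X a = (- \<tau>) *\<^sub>R ?\<delta>\<close> have "?X a = ?X 0" by (simp add: zero)
  then have "a = 0" using inj_coord_vec[OF c] by (rule injD[rotated])
  then show ?thesis
    using \<open>\<tau> = 0\<close> linear_0[OF L.linear_coord_vec[OF C]] by (simp add: u zero_prod_def)
qed

text \<open>Given conservation of energy (\<open>cons\<close>), \<open>t' = (\<langle>\<delta>, x'\<rangle> - E) / \<beta>\<close>, and pairing either equation with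
  \<open>\<delta>\<close> determines \<open>t''\<close>; the coefficients \<open>R0\<close>, \<open>R1\<close>, \<open>R2\<close> are those of \<open>t'\<^sup>2\<close>, \<open>t'\<close>, \<open>1\<close>.\<close>

lemma spatial_equation_iff:
  assumes v: "v \<in> tangent_space A p" and X: "X \<in> tangent_space A p"
    and E: "E = - \<beta> p * t1 + g p (\<delta> p) v"
    and cons: "\<beta> p * t2 + t1 * v \<beta> = g p X (\<delta> p) + g p v (nabR p v \<delta>)"
  shows "X + t2 *\<^sub>R \<delta> p - t1 *\<^sub>R sharp A g p (\<lambda>y. rot g nabR \<delta> p y v) + (t1\<^sup>2 / 2) *\<^sub>R grad A g \<beta> p = 0 \<longleftrightarrow>
    X = R0_bar A g \<beta> \<delta> E p + R1_bar A g nabR \<beta> \<delta> E p v + R2_bar A g nabR \<beta> \<delta> p v"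
proof -
  let ?\<delta> = "\<delta> p" and ?B = "grad A g \<beta> p" and ?N = "sharp A g p (\<lambda>y. rot g nabR \<delta> p y v)"
  note \<delta> = \<delta>_in_tangent_space[of p] and B = grad_in_tangent_space[of \<beta> p]
    and N = sharp_rot_in_tangent_space[OF v smooth_vf_near_\<delta>]
  let ?n = "g p ?\<delta> ?\<delta>" and ?s = "g p v (nabR p v \<delta>)" and ?b = "g p ?\<delta> ?B" and ?r = "rot g nabR \<delta> p v ?\<delta>"
  let ?L = "Lam g \<beta> \<delta> p"
  \<comment> \<open>The total coefficient of \<open>\<delta>\<close> on the right-hand side of the
    spatial equation; it will turn out to be \<open>- t2\<close>.\<close>
  define k where "k = ?L * (- (t1\<^sup>2 / 2) * ?b - t1 * (v \<beta> + ?r) + ?s)"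
  have n: "?n \<ge> 0"
    using metric_pos[OF \<delta>] metric_zero_left[OF \<delta>] by (cases "?\<delta> = 0") auto
  have pos: "\<beta> p + ?n > 0" using n \<beta>_pos[of p] by simp
  have L: "?L = - 1 / (\<beta> p + ?n)"
    using n by (simp add: Lam_def metric_norm_def)
  have gB: "g p ?B v = v \<beta>"
    using metric_grad[OF v, of \<beta>] metric_sym[OF B v] by simp
  have s: "sym_nab g nabR \<delta> p v v = ?s"
    using metric_sym[OF nab_in_tangent_space[OF v smooth_vf_near_\<delta>] v] by (simp add: sym_nab_def nab_form_def)
  have t1: "t1 = (g p ?\<delta> v - E) / \<beta> p"
    using E \<beta>_pos[of p] by (simp add: field_simps)
  have R0: "R0 A g \<beta> \<delta> p = (- (?L * ?b) / 2) *\<^sub>R ?\<delta> - (1/2) *\<^sub>R ?B"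
    by (simp add: R0_def scaleR_add_right)
  have R1: "R1 A g nabR \<beta> \<delta> p v = (- ?L * (v \<beta> + ?r)) *\<^sub>R ?\<delta> + ?N"
    by (simp add: R1_def gB)
  have R2: "R2 g nabR \<beta> \<delta> p v v = (?L * ?s) *\<^sub>R ?\<delta>"
    by (simp add: R2_def s)
  \<comment> \<open>Collecting terms, \<open>R0\<close> receives a perfect square, namely the square
    of \<open>t1 = (g p ?\<delta> v - E) / \<beta> p\<close>, and \<open>R1\<close> receives
    \<open>t1\<close> itself.\<close>
  have "R0_bar A g \<beta> \<delta> E p + R1_bar A g nabR \<beta> \<delta> E p v + R2_bar A g nabR \<beta> \<delta> p v =
    (E\<^sup>2 / (\<beta> p)\<^sup>2 - E / \<beta> p * (2 * (g p ?\<delta> v / \<beta> p)) + (g p ?\<delta> v)\<^sup>2 / (\<beta> p)\<^sup>2) *\<^sub>R R0 A g \<beta> \<delta> p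
    + (- (E / \<beta> p) + g p ?\<delta> v / \<beta> p) *\<^sub>R R1 A g nabR \<beta> \<delta> p v + R2 g nabR \<beta> \<delta> p v v"
    by (simp add: R0_bar_def R1_bar_def R2_bar_def scaleR_add_right scaleR_add_left scaleR_diff_left)
  moreover have "E\<^sup>2 / (\<beta> p)\<^sup>2 - E / \<beta> p * (2 * (g p ?\<delta> v / \<beta> p)) + (g p ?\<delta> v)\<^sup>2 / (\<beta> p)\<^sup>2 = t1\<^sup>2"
    unfolding t1 using \<beta>_pos[of p] by (simp add: power_divide power2_diff diff_divide_distrib add_divide_distrib)
  moreover have "- (E / \<beta> p) + g p ?\<delta> v / \<beta> p = t1"
    unfolding t1 by (simp add: diff_divide_distrib)
  moreover have "t1\<^sup>2 *\<^sub>R R0 A g \<beta> \<delta> p + t1 *\<^sub>R R1 A g nabR \<beta> \<delta> p v + R2 g nabR \<beta> \<delta> p v v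
      = k *\<^sub>R ?\<delta> + t1 *\<^sub>R ?N - (t1\<^sup>2 / 2) *\<^sub>R ?B"
  proof -
    have vec: "m1 *\<^sub>R (a *\<^sub>R d - (1/2) *\<^sub>R B) + m2 *\<^sub>R (b *\<^sub>R d + N) + e *\<^sub>R d =
        (m1 * a + m2 * b + e) *\<^sub>R d + m2 *\<^sub>R N - (m1 / 2) *\<^sub>R B" for m1 m2 a b e and d B N :: "'a tvec"
      by (simp add: scaleR_add_right scaleR_add_left scaleR_diff_right)
    have "k = t1\<^sup>2 * (- (?L * ?b) / 2) + t1 * (- ?L * (v \<beta> + ?r)) + ?L * ?s"
      by (simp add: k_def algebra_simps)
    then show ?thesis
      by (simp only: R0 R1 R2 vec)
  qed
  ultimately have rhs: "R0_bar A g \<beta> \<delta> E p + R1_bar A g nabR \<beta> \<delta> E p v + R2_bar A g nabR \<beta> \<delta> p v =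
    k *\<^sub>R ?\<delta> + t1 *\<^sub>R ?N - (t1\<^sup>2 / 2) *\<^sub>R ?B"
    by (simp only:)
  \<comment> \<open>Serves both directions: in each, \<open>X\<close> has this shape, with
    \<open>l = - t2\<close> from the first equation and \<open>l = k\<close> from the second.
    Pairing with \<open>\<delta>\<close> and using \<open>cons\<close> gives \<open>(t2 + k)\<close>
    times \<open>\<beta> p + ?n\<close> or times \<open>\<beta> p\<close>, both positive, equal to
    0.\<close>
  have key: "t2 = - k" if X': "X = l *\<^sub>R ?\<delta> + t1 *\<^sub>R ?N - (t1\<^sup>2 / 2) *\<^sub>R ?B" and l: "l = - t2 \<or> l = k" for l
  proof -
    have "g p ?\<delta> X = l * ?n + t1 * rot g nabR \<delta> p ?\<delta> v - t1\<^sup>2 / 2 * ?b"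
      unfolding X' using \<delta> N B
      by (simp add: metric_add_right metric_diff_right metric_scale_right tangent_space_closed
          metric_sharp_rot[OF v smooth_vf_near_\<delta>])
    moreover have "rot g nabR \<delta> p ?\<delta> v = - ?r" by (simp add: rot_def)
    ultimately have c: "\<beta> p * t2 + t1 * v \<beta> = l * ?n - t1 * ?r - t1\<^sup>2 / 2 * ?b + ?s"
      using cons metric_sym[OF X \<delta>] by simp
    have "k * (\<beta> p + ?n) = t1\<^sup>2 / 2 * ?b + t1 * (v \<beta> + ?r) - ?s"
      unfolding k_def L using pos by (simp add: field_simps)
    with c have "\<beta> p * t2 + k * (\<beta> p + ?n) = l * ?n" by (simp add: algebra_simps)
    with l have "(t2 + k) * (\<beta> p + ?n) = 0 \<or> (t2 + k) * \<beta> p = 0"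
      by (auto simp: algebra_simps)
    then show ?thesis using pos \<beta>_pos[of p] by auto
  qed
  show ?thesis
  proof
    assume "X + t2 *\<^sub>R ?\<delta> - t1 *\<^sub>R ?N + (t1\<^sup>2 / 2) *\<^sub>R ?B = 0"
    then have X': "X = (- t2) *\<^sub>R ?\<delta> + t1 *\<^sub>R ?N - (t1\<^sup>2 / 2) *\<^sub>R ?B"
      by (simp add: algebra_simps add_eq_0_iff2)
    with key[OF X'] show "X = R0_bar A g \<beta> \<delta> E p + R1_bar A g nabR \<beta> \<delta> E p v + R2_bar A g nabR \<beta> \<delta> p v"
      by (simp add: rhs)
  next
    assume "X = R0_bar A g \<beta> \<delta> E p + R1_bar A g nabR \<beta> \<delta> E p v + R2_bar A g nabR \<beta> \<delta> p v"
    then have X': "X = k *\<^sub>R ?\<delta> + t1 *\<^sub>R ?N - (t1\<^sup>2 / 2) *\<^sub>R ?B" by (simp add: rhs)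
    with key[OF X'] show "X + t2 *\<^sub>R ?\<delta> - t1 *\<^sub>R ?N + (t1\<^sup>2 / 2) *\<^sub>R ?B = 0"
      by simp
  qed
qed

end

section \<open>A curve in the spacetime and its spatial part\<close>

locale stationary_curve = stationary_spacetime A g nabR \<beta> \<delta> nab
  for A :: "('a::topological_space, 'e::euclidean_space) chart set"
    and g :: "'a metric_tensor" and nabR :: "'a connection"
    and \<beta> :: "'a \<Rightarrow> real" and \<delta> :: "'a \<Rightarrow> 'a tvec" and nab :: "(real \<times> 'a) connection" +
  fixes I :: "real set" and t :: "real \<Rightarrow> real" and x :: "real \<Rightarrow> 'a"
  assumes open_interval: "open I" and smooth: "smooth_curve (line_prod A) I (\<lambda>s. (t s, x s))"

sublocale stationary_curve \<subseteq> riemannian_curve A g nabR I x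
  by standard (rule open_interval, rule smooth_curve_snd[OF open_interval smooth])

sublocale stationary_curve \<subseteq> L: pseudo_riemannian_curve
    "line_prod A" "stationary_metric A g \<beta> \<delta>" nab I "\<lambda>s. (t s, x s)"
  by standard (rule open_interval, rule smooth)

context stationary_curve
begin

abbreviation "\<gamma> \<equiv> \<lambda>s. (t s, x s)"
abbreviation "X s \<equiv> cov_deriv_along A nabR x (velocity A x) s"
abbreviation "D s \<equiv> cov_deriv_along (line_prod A) nab \<gamma> (velocity (line_prod A) \<gamma>) s"
abbreviation "energy s \<equiv> gL (\<gamma> s) (velocity (line_prod A) \<gamma> s) (partial_t A (\<gamma> s))"

lemma line_chart_at: "c \<in> A \<Longrightarrow> x s \<in> fst c \<Longrightarrow> line_chart c \<in> line_prod A \<and> \<gamma> s \<in> fst (line_chart c)"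
  by (simp add: line_chart_in_line_prod)

lemma line_coord_velocity:
  assumes c: "c \<in> A" "x s \<in> fst c" and s: "s \<in> I"
  shows "L.coord_velocity (line_chart c) s = (deriv t s, coord_velocity c s)"
proof -
  note C = line_chart_at[OF c]
  let ?v = "L.coord_velocity (line_chart c) s"
  have v: "((snd (line_chart c) \<circ> \<gamma>) has_vector_derivative ?v) (at s)"
    using C by (intro L.coord_velocity s) auto
  have "(t has_vector_derivative fst ?v) (at s)"
    using bounded_linear.has_vector_derivative[OF bounded_linear_fst v] by (simp add: o_def)
  then have "deriv t s = fst ?v"
    by (intro DERIV_imp_deriv) (simp add: has_real_derivative_iff_has_vector_derivative)
  moreover have "((snd c \<circ> x) has_vector_derivative snd ?v) (at s)"
    using bounded_linear.has_vector_derivative[OF bounded_linear_snd v] by (simp add: o_def)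
  then have "coord_velocity c s = snd ?v" by (rule vector_derivative_at)
  ultimately show ?thesis by simp
qed

lemma line_velocity_eq:
  assumes "c \<in> A" "x s \<in> fst c" "s \<in> I"
  shows "velocity (line_prod A) \<gamma> s =
    coord_vec (line_prod A) (line_chart c) (\<gamma> s) (deriv t s, coord_velocity c s)"
proof -
  have "velocity (line_prod A) \<gamma> s =
      coord_vec (line_prod A) (line_chart c) (\<gamma> s) (L.coord_velocity (line_chart c) s)"
    using line_chart_at[OF assms(1,2)] assms(3) by (intro L.velocity_eq) auto
  then show ?thesis by (simp only: line_coord_velocity[OF assms])
qed

text \<open>Smoothness of \<open>t\<close> is available only through the product charts, so
  \<open>deriv t\<close> is first recognised as a component of the coordinate velocity.\<close>

lemma has_real_derivative_deriv_t:
  assumes s: "s \<in> I"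
  shows "(deriv t has_real_derivative deriv (deriv t) s) (at s)"
proof -
  obtain c where c: "c \<in> A" "x s \<in> fst c" by (rule chart_at)
  note C = line_chart_at[OF c]
  have "(\<lambda>r. fst (L.coord_velocity (line_chart c) r)) differentiable at s"
    using L.coord_velocity_differentiable[of "line_chart c" s] C s
      differentiable_compose[of fst] bounded_linear_imp_differentiable[OF bounded_linear_fst] by blast
  then obtain d where "((\<lambda>r. fst (L.coord_velocity (line_chart c) r)) has_real_derivative d) (at s)"
    by (auto simp: real_differentiable_def)
  then have "(deriv t has_real_derivative d) (at s)"
    by (rule has_field_derivative_transform_within_open[OF _ open_domain[OF c(1)]])
      (use c s line_coord_velocity in auto)
  then show ?thesis using DERIV_imp_deriv by metis
qed

lemma metric_velocity_coord_vec:
  assumes c: "c \<in> A" "x s \<in> fst c" and s: "s \<in> I"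
  shows "gL (\<gamma> s) (velocity (line_prod A) \<gamma> s) (coord_vec (line_prod A) (line_chart c) (\<gamma> s) b) =
    - \<beta> (x s) * deriv t s * fst b + g (x s) (velocity A x s) (coord_vec A c (x s) (snd b))
    + deriv t s * g (x s) (\<delta> (x s)) (coord_vec A c (x s) (snd b))
    + fst b * g (x s) (\<delta> (x s)) (velocity A x s)"
  unfolding line_velocity_eq[OF c s] velocity_eq[OF c(1) s c(2)]
  using lorentz_coord_vec[of c "\<gamma> s" "(deriv t s, coord_velocity c s)" b] c by simp

lemma energy_eq:
  assumes s: "s \<in> I"
  shows "energy s = - \<beta> (x s) * deriv t s + g (x s) (\<delta> (x s)) (velocity A x s)"
proof -
  obtain c where c: "c \<in> A" "x s \<in> fst c" by (rule chart_at)
  have v: "velocity A x s \<in> tangent_space A (x s)" by (rule velocity_in_tangent_space[OF s])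
  have zero: "coord_vec A c (x s) 0 = 0" by (rule linear_0[OF linear_coord_vec[OF c]])
  have T0: "0 \<in> tangent_space A (x s)" by (rule tangent_space_closed)
  show ?thesis
    using metric_velocity_coord_vec[OF c s, of "(1, 0)"] partial_t_eq[of c "\<gamma> s"] c
      metric_sym[OF v T0] metric_zero_left[OF v]
      metric_sym[OF \<delta>_in_tangent_space T0] metric_zero_left[OF \<delta>_in_tangent_space]
    by (simp add: zero)
qed

text \<open>E' in spatial terms, obtained by taking \<open>\<delta>\<close> itself as test field.
  Setting it to 0 gives the hypothesis \<open>cons\<close> of
  \<open>spatial_equation_iff\<close>.\<close>

lemma has_real_derivative_energy:
  assumes s: "s \<in> I"
  shows "(energy has_real_derivative
    - (\<beta> (x s) * deriv (deriv t) s + deriv t s * velocity A x s \<beta>)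
    + (g (x s) (X s) (\<delta> (x s)) + g (x s) (velocity A x s) (nabR (x s) (velocity A x s) \<delta>))) (at s)"
proof -
  have "((\<lambda>r. - (\<beta> (x r) * deriv t r) + g (x r) (velocity A x r) (\<delta> (x r))) has_real_derivative
    - (velocity A x s \<beta> * deriv t s + deriv (deriv t) s * \<beta> (x s))
    + (g (x s) (X s) (\<delta> (x s)) + g (x s) (velocity A x s) (nabR (x s) (velocity A x s) \<delta>))) (at s)"
    by (intro DERIV_add DERIV_minus DERIV_mult has_real_derivative_velocity[OF s smooth_near_\<beta>]
        has_real_derivative_deriv_t[OF s] has_real_derivative_metric_velocity_along[OF s smooth_vf_near_\<delta>])
  then have "(energy has_real_derivative
    - (velocity A x s \<beta> * deriv t s + deriv (deriv t) s * \<beta> (x s))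
    + (g (x s) (X s) (\<delta> (x s)) + g (x s) (velocity A x s) (nabR (x s) (velocity A x s) \<delta>))) (at s)"
    by (rule has_field_derivative_transform_within_open[OF _ open_interval s])
      (use energy_eq metric_sym[OF velocity_in_tangent_space \<delta>_in_tangent_space] in simp)
  then show ?thesis by (rule DERIV_cong) simp
qed

lemma line_cov_deriv:
  assumes s: "s \<in> I"
  obtains c where "c \<in> A" "x s \<in> fst c"
    "D s = cov_deriv_in_chart (line_prod A) (line_chart c) nab \<gamma> (velocity (line_prod A) \<gamma>) s"
proof -
  \<comment> \<open>Whatever chart was selected, it is a product chart, and its spatial factor
    \<open>c\<close> is the chart of the computations below. The chart hidden in \<open>X s\<close>
    may be a different one.\<close>
  let ?C = "SOME C. C \<in> line_prod A \<and> \<gamma> s \<in> fst C"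
  have "\<exists>C. C \<in> line_prod A \<and> \<gamma> s \<in> fst C" using L.chart_at by metis
  then have "?C \<in> line_prod A \<and> \<gamma> s \<in> fst ?C" by (rule someI_ex)
  then obtain c where "c \<in> A" "?C = line_chart c" "\<gamma> s \<in> fst (line_chart c)"
    unfolding line_prod_eq by auto
  then show ?thesis
    using that[of c] unfolding cov_deriv_along_def by simp
qed

text \<open>The Riemannian half-square term is turned back into a product with \<open>nabR\<close>,
  so that it cancels against the same term in the derivative formula for the spatial curve.\<close>

lemma has_real_derivative_lorentz_coord_vec:
  assumes c: "c \<in> A" "x s \<in> fst c" and s: "s \<in> I"
    and D: "D s = cov_deriv_in_chart (line_prod A) (line_chart c) nab \<gamma> (velocity (line_prod A) \<gamma>) s"
  shows "((\<lambda>r. gL (\<gamma> r) (velocity (line_prod A) \<gamma> r) (coord_vec (line_prod A) (line_chart c) (\<gamma> r) b))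
    has_real_derivative gL (\<gamma> s) (D s) (coord_vec (line_prod A) (line_chart c) (\<gamma> s) b)
      - (deriv t s)\<^sup>2 / 2 * coord_vec A c (x s) (snd b) \<beta>
      + g (x s) (velocity A x s) (nabR (x s) (velocity A x s) (\<lambda>q. coord_vec A c q (snd b)))
      + deriv t s * coord_vec A c (x s) (snd b) (\<lambda>q. g q (\<delta> q) (coord_vec A c q (coord_velocity c s)))) (at s)"
proof -
  let ?a = "(deriv t s, coord_velocity c s)"
  have C: "line_chart c \<in> line_prod A" "\<gamma> s \<in> fst (line_chart c)"
    using line_chart_at[OF c] by auto
  have c': "snd (\<gamma> s) \<in> fst c" using c by simp
  note E = L.has_real_derivative_metric_velocity[OF C s L.smooth_vf_near_coord_vec[OF C]
      smooth_near_lorentz_coord_vec[OF c(1) c']]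
  have "gL (\<gamma> s) (velocity (line_prod A) \<gamma> s)
      (nab (\<gamma> s) (velocity (line_prod A) \<gamma> s) (\<lambda>q. coord_vec (line_prod A) (line_chart c) q b)) =
    - (deriv t s)\<^sup>2 / 2 * coord_vec A c (x s) (snd b) \<beta>
    + 1/2 * coord_vec A c (x s) (snd b)
        (\<lambda>q. g q (coord_vec A c q (coord_velocity c s)) (coord_vec A c q (coord_velocity c s)))
    + deriv t s * coord_vec A c (x s) (snd b) (\<lambda>q. g q (\<delta> q) (coord_vec A c q (coord_velocity c s)))"
    unfolding L.metric_velocity_nab_coord_vec[OF C s] line_coord_velocity[OF c s]
      coord_vec_lorentz[OF c(1) c']
    by (simp add: algebra_simps power2_eq_square)
  then show ?thesis
    unfolding D metric_velocity_nab_coord_vec[OF c s] by (intro DERIV_cong[OF E]) simp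
qed

text \<open>For the time direction all terms besides the covariant derivative differentiate along
  the zero spatial vector.\<close>

lemma lorentz_cov_deriv_t:
  assumes c: "c \<in> A" "x s \<in> fst c" and s: "s \<in> I"
    and D: "D s = cov_deriv_in_chart (line_prod A) (line_chart c) nab \<gamma> (velocity (line_prod A) \<gamma>) s"
  shows "(energy has_real_derivative
    gL (\<gamma> s) (D s) (coord_vec (line_prod A) (line_chart c) (\<gamma> s) (1, 0))) (at s)"
proof -
  have v: "velocity A x s \<in> tangent_space A (x s)" by (rule velocity_in_tangent_space[OF s])
  have zero: "coord_vec A c q 0 = 0" if "q \<in> fst c" for q
    by (rule linear_0[OF linear_coord_vec[OF c(1) that]])
  \<comment> \<open>The field \<open>\<lambda>q. coord_vec A c q 0\<close> is known to be zero only
    inside the chart, so its covariant derivative is evaluated through the half-square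
    formula.\<close>
  have "g (x s) (velocity A x s) (nabR (x s) (velocity A x s) (\<lambda>q. coord_vec A c q 0)) = 0"
    using metric_velocity_nab_coord_vec[OF c s, of 0] by (simp add: zero[OF c(2)])
  then have "((\<lambda>r. gL (\<gamma> r) (velocity (line_prod A) \<gamma> r) (coord_vec (line_prod A) (line_chart c) (\<gamma> r) (1, 0)))
    has_real_derivative gL (\<gamma> s) (D s) (coord_vec (line_prod A) (line_chart c) (\<gamma> s) (1, 0))) (at s)"
    using has_real_derivative_lorentz_coord_vec[OF c s D, of "(1, 0)"] by (simp add: zero[OF c(2)])
  then show ?thesis
    by (rule has_field_derivative_transform_within_open[OF _ open_domain[OF c(1)]])
      (use c s partial_t_eq[OF c(1)] in auto)
qed

text \<open>The product of the velocity with a spatial coordinate field is differentiated twice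
  over: by the spatial formulas, where \<open>X s\<close> appears, and by the Lorentz one, where
  \<open>D s\<close> appears. Uniqueness of derivatives compares the two although their charts may
  differ.\<close>

lemma lorentz_cov_deriv_x:
  assumes c: "c \<in> A" "x s \<in> fst c" and s: "s \<in> I"
    and D: "D s = cov_deriv_in_chart (line_prod A) (line_chart c) nab \<gamma> (velocity (line_prod A) \<gamma>) s"
  shows "gL (\<gamma> s) (D s) (coord_vec (line_prod A) (line_chart c) (\<gamma> s) (0, b)) =
    g (x s) (coord_vec A c (x s) b) (X s + deriv (deriv t) s *\<^sub>R \<delta> (x s)
      - deriv t s *\<^sub>R sharp A g (x s) (\<lambda>y. rot g nabR \<delta> (x s) y (velocity A x s))
      + ((deriv t s)\<^sup>2 / 2) *\<^sub>R grad A g \<beta> (x s))"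
proof -
  let ?p = "x s" and ?v = "velocity A x s" and ?b = "coord_vec A c (x s) b"
  let ?Z = "\<lambda>q. coord_vec A c q b" and ?V = "\<lambda>q. coord_vec A c q (coord_velocity c s)"
  note coords = smooth_vf_near_coord_vec[OF c] coord_vec_in_tangent_space[OF c]
  have v: "?v \<in> tangent_space A ?p" by (rule velocity_in_tangent_space[OF s])
  have vV: "?v = ?V ?p" by (rule velocity_eq[OF c(1) s c(2)])
  note T = coords(2) v \<delta>_in_tangent_space[of ?p] nab_in_tangent_space[OF v smooth_vf_near_\<delta>]
    nab_in_tangent_space[OF coords(2) smooth_vf_near_\<delta>]
  have "((\<lambda>r. g (x r) (velocity A x r) (?Z (x r)) + deriv t r * g (x r) (\<delta> (x r)) (?Z (x r)))
    has_real_derivative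
    (g ?p (X s) ?b + g ?p ?v (nabR ?p ?v ?Z))
    + (deriv (deriv t) s * g ?p (\<delta> ?p) ?b + ?v (\<lambda>q. g q (\<delta> q) (?Z q)) * deriv t s)) (at s)"
    by (intro DERIV_add DERIV_mult has_real_derivative_deriv_t[OF s]
        has_real_derivative_velocity[OF s smooth_near_metric[OF smooth_vf_near_\<delta> coords(1)]]
        has_real_derivative_metric_velocity_along[OF s coords(1)])
  then have "((\<lambda>r. gL (\<gamma> r) (velocity (line_prod A) \<gamma> r) (coord_vec (line_prod A) (line_chart c) (\<gamma> r) (0, b)))
    has_real_derivative
    (g ?p (X s) ?b + g ?p ?v (nabR ?p ?v ?Z))
    + (deriv (deriv t) s * g ?p (\<delta> ?p) ?b + ?v (\<lambda>q. g q (\<delta> q) (?Z q)) * deriv t s)) (at s)"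
    by (rule has_field_derivative_transform_within_open[OF _ open_domain[OF c(1)]])
      (use c s metric_velocity_coord_vec[OF c(1)] in auto)
  from DERIV_unique[OF this has_real_derivative_lorentz_coord_vec[OF c s D]]
  have eq: "gL (\<gamma> s) (D s) (coord_vec (line_prod A) (line_chart c) (\<gamma> s) (0, b)) =
    g ?p (X s) ?b + deriv (deriv t) s * g ?p (\<delta> ?p) ?b
    + deriv t s * (?v (\<lambda>q. g q (\<delta> q) (?Z q)) - ?b (\<lambda>q. g q (\<delta> q) (?V q)))
    + (deriv t s)\<^sup>2 / 2 * ?b \<beta>"
    by (simp add: algebra_simps)
  \<comment> \<open>By compatibility both derivatives contain the product of \<open>\<delta>\<close>
    with this common vector; it cancels, and the antisymmetric part of the derivative of
    \<open>\<delta>\<close> remains.\<close>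
  have "nabR ?p ?v ?Z = nabR ?p ?b ?V"
    unfolding vV by (rule nab_coord_vec_commute[OF c])
  then have "?v (\<lambda>q. g q (\<delta> q) (?Z q)) - ?b (\<lambda>q. g q (\<delta> q) (?V q)) =
      g ?p (nabR ?p ?v \<delta>) ?b - g ?p (nabR ?p ?b \<delta>) (?V ?p)"
    using metric_compatible[OF v smooth_vf_near_\<delta> coords(1), of b]
      metric_compatible[OF coords(2) smooth_vf_near_\<delta> coords(1), of b "coord_velocity c s"] by simp
  also have "\<dots> = - rot g nabR \<delta> ?p ?b ?v"
    by (simp add: rot_def nab_form_def vV[symmetric])
  finally show ?thesis
    unfolding eq
    using T sharp_rot_in_tangent_space[OF v smooth_vf_near_\<delta>] grad_in_tangent_space
      cov_deriv_along_in_tangent_space[OF s]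
    by (simp add: metric_add_right metric_diff_right metric_scale_right tangent_space_closed
        metric_grad metric_sharp_rot[OF v smooth_vf_near_\<delta>] metric_sym[of _ ?p ?b])
qed

text \<open>The whole equivalence at a single parameter. Using \<open>energy s\<close> as E here
  postpones the question whether the energy is constant along the curve.\<close>

lemma geodesic_at_iff:
  assumes s: "s \<in> I"
  shows "D s = 0 \<longleftrightarrow> (energy has_real_derivative 0) (at s) \<and>
    X s = R0_bar A g \<beta> \<delta> (energy s) (x s) + R1_bar A g nabR \<beta> \<delta> (energy s) (x s) (velocity A x s)
      + R2_bar A g nabR \<beta> \<delta> (x s) (velocity A x s)" (is "_ \<longleftrightarrow> ?cons \<and> ?eq")
proof -
  obtain c where c: "c \<in> A" "x s \<in> fst c"
    and D: "D s = cov_deriv_in_chart (line_prod A) (line_chart c) nab \<gamma> (velocity (line_prod A) \<gamma>) s"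
    by (rule line_cov_deriv[OF s])
  let ?C = "coord_vec (line_prod A) (line_chart c) (\<gamma> s)"
  let ?W = "X s + deriv (deriv t) s *\<^sub>R \<delta> (x s)
      - deriv t s *\<^sub>R sharp A g (x s) (\<lambda>y. rot g nabR \<delta> (x s) y (velocity A x s))
      + ((deriv t s)\<^sup>2 / 2) *\<^sub>R grad A g \<beta> (x s)"
  have C: "line_chart c \<in> line_prod A" "\<gamma> s \<in> fst (line_chart c)"
    using line_chart_at[OF c] by auto
  have c': "snd (\<gamma> s) \<in> fst c" using c by simp
  have v: "velocity A x s \<in> tangent_space A (x s)" by (rule velocity_in_tangent_space[OF s])
  have X: "X s \<in> tangent_space A (x s)" by (rule cov_deriv_along_in_tangent_space[OF s])
  have W: "?W \<in> tangent_space A (x s)"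
    by (intro tangent_space_closed X \<delta>_in_tangent_space grad_in_tangent_space
        sharp_rot_in_tangent_space[OF v smooth_vf_near_\<delta>])
  have DT: "D s \<in> tangent_space (line_prod A) (\<gamma> s)"
    unfolding D by (rule L.cov_deriv_in_chart_in_tangent_space[OF C(1) s C(2)])
  have t: "gL (\<gamma> s) (D s) (?C (1, 0)) = 0 \<longleftrightarrow> ?cons"
  proof
    assume "gL (\<gamma> s) (D s) (?C (1, 0)) = 0"
    then show ?cons using lorentz_cov_deriv_t[OF c s D] by simp
  next
    assume ?cons
    then show "gL (\<gamma> s) (D s) (?C (1, 0)) = 0" by (rule DERIV_unique[OF lorentz_cov_deriv_t[OF c s D]])
  qed
  have x: "(\<forall>b. gL (\<gamma> s) (D s) (?C (0, b)) = 0) \<longleftrightarrow> ?W = 0"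
  proof
    assume 0: "\<forall>b. gL (\<gamma> s) (D s) (?C (0, b)) = 0"
    show "?W = 0"
    proof (rule metric_eqI[OF W tangent_space_closed(1)])
      fix u assume u: "u \<in> tangent_space A (x s)"
      then obtain b where "u = coord_vec A c (x s) b" unfolding tangent_space_eq[OF c] by auto
      then show "g (x s) u ?W = g (x s) u 0"
        using 0 lorentz_cov_deriv_x[OF c s D, of b] metric_zero_left[OF u]
          metric_sym[OF u tangent_space_closed(1)] by simp
    qed
  next
    assume "?W = 0"
    then show "\<forall>b. gL (\<gamma> s) (D s) (?C (0, b)) = 0"
      using lorentz_cov_deriv_x[OF c s D] metric_zero_left[OF coord_vec_in_tangent_space[OF c]]
        metric_sym[OF coord_vec_in_tangent_space[OF c] tangent_space_closed(1)] by simp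
  qed
  have "D s = 0 \<longleftrightarrow> gL (\<gamma> s) (D s) (?C (1, 0)) = 0 \<and> (\<forall>b. gL (\<gamma> s) (D s) (?C (0, b)) = 0)"
  proof
    assume "D s = 0"
    then show "gL (\<gamma> s) (D s) (?C (1, 0)) = 0 \<and> (\<forall>b. gL (\<gamma> s) (D s) (?C (0, b)) = 0)"
      using L.metric_zero_left[OF L.coord_vec_in_tangent_space[OF C]] by simp
  next
    assume "gL (\<gamma> s) (D s) (?C (1, 0)) = 0 \<and> (\<forall>b. gL (\<gamma> s) (D s) (?C (0, b)) = 0)"
    then show "D s = 0" by (intro lorentz_nondegenerate[OF c(1) c' DT]) blast+
  qed
  also have "\<dots> \<longleftrightarrow> ?cons \<and> ?W = 0"
    unfolding t x ..
  also have "\<dots> \<longleftrightarrow> ?cons \<and> ?eq"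
  \<comment> \<open>Eliminating t'' uses E' = 0, so the second conjunct is rewritten under the
    first.\<close>
  proof (rule conj_cong[OF refl])
    assume ?cons
    from DERIV_unique[OF has_real_derivative_energy[OF s] this]
    have "\<beta> (x s) * deriv (deriv t) s + deriv t s * velocity A x s \<beta> =
        g (x s) (X s) (\<delta> (x s)) + g (x s) (velocity A x s) (nabR (x s) (velocity A x s) \<delta>)"
      by simp
    then show "?W = 0 \<longleftrightarrow> ?eq"
      by (rule spatial_equation_iff[OF v X energy_eq[OF s]])
  qed
  finally show ?thesis .
qed

end

theorem theorem2:
  fixes A :: "('a::{t2_space, second_countable_topology}, 'e::euclidean_space) chart set"
    and g :: "'a metric_tensor" and \<beta> :: "'a \<Rightarrow> real" and \<delta> :: "'a \<Rightarrow> 'a tvec"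
    and nabR :: "'a connection" and nab :: "(real \<times> 'a) connection"
    and I :: "real set" and t :: "real \<Rightarrow> real" and x :: "real \<Rightarrow> 'a"
  defines "gL \<equiv> stationary_metric A g \<beta> \<delta>"
    and "\<gamma> \<equiv> \<lambda>s. (t s, x s)"
  assumes "standard_stationary A g \<beta> \<delta>"
    and "levi_civita A g nabR"
    and "levi_civita (line_prod A) gL nab"
    and "open I" and "is_interval I"
    and "smooth_curve (line_prod A) I \<gamma>"
  shows "geodesic_on (line_prod A) nab I \<gamma> \<longleftrightarrow>
    (\<exists>E. (\<forall>s\<in>I. gL (\<gamma> s) (velocity (line_prod A) \<gamma> s) (partial_t A (\<gamma> s)) = E) \<and>
         (\<forall>s\<in>I. cov_deriv_along A nabR x (velocity A x) s =
            R0_bar A g \<beta> \<delta> E (x s) + R1_bar A g nabR \<beta> \<delta> E (x s) (velocity A x s)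
            + R2_bar A g nabR \<beta> \<delta> (x s) (velocity A x s)))"
proof -
  interpret stationary_curve A g nabR \<beta> \<delta> nab I t x
    using assms by unfold_locales (auto simp: standard_stationary_def)
  \<comment> \<open>Passes from the energy at each parameter to one constant that serves in both
    conjuncts.\<close>
  have ex: "(\<exists>E. \<forall>s\<in>I. e s = E) \<and> (\<forall>s\<in>I. P (e s) s) \<longleftrightarrow> (\<exists>E. (\<forall>s\<in>I. e s = E) \<and> (\<forall>s\<in>I. P E s))"
    for e :: "real \<Rightarrow> real" and P
    by (intro iffI; elim exE conjE; intro exI conjI; assumption?) auto
  let ?Q = "\<lambda>E s. X s = R0_bar A g \<beta> \<delta> E (x s) + R1_bar A g nabR \<beta> \<delta> E (x s) (velocity A x s)
      + R2_bar A g nabR \<beta> \<delta> (x s) (velocity A x s)"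
  have geodesic: "geodesic_on (line_prod A) nab I (\<lambda>s. (t s, x s)) \<longleftrightarrow>
    (\<forall>s\<in>I. (energy has_real_derivative 0) (at s)) \<and> (\<forall>s\<in>I. ?Q (energy s) s)"
    using smooth geodesic_at_iff unfolding geodesic_on_def by blast
  have energy: "(\<forall>s\<in>I. (energy has_real_derivative 0) (at s)) \<longleftrightarrow> (\<exists>E. \<forall>s\<in>I. energy s = E)"
  proof
    assume "\<forall>s\<in>I. (energy has_real_derivative 0) (at s)"
    then have "\<And>s. s \<in> I \<Longrightarrow> (energy has_real_derivative 0) (at s within I)"
      by (blast intro: has_field_derivative_at_within)
    \<comment> \<open>An interval is convex, so a vanishing derivative makes the energy a single
      constant.\<close>
    from has_field_derivative_zero_constant[OF is_interval_convex[OF \<open>is_interval I\<close>] this]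
    show "\<exists>E. \<forall>s\<in>I. energy s = E" by blast
  next
    assume "\<exists>E. \<forall>s\<in>I. energy s = E"
    then obtain E where E: "\<forall>s\<in>I. energy s = E" ..
    show "\<forall>s\<in>I. (energy has_real_derivative 0) (at s)"
    proof
      fix s assume "s \<in> I"
      \<comment> \<open>As \<open>I\<close> is open, the energy equals the constant on a
        neighbourhood of \<open>s\<close>, which gives the two-sided derivative.\<close>
      show "(energy has_real_derivative 0) (at s)"
        by (rule has_field_derivative_transform_within_open[OF DERIV_const open_interval \<open>s \<in> I\<close> E[rule_format, symmetric]])
    qed
  qed
  show ?thesis
    unfolding gL_def \<gamma>_def geodesic energy by (rule ex[of energy ?Q])
qed

end
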